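(* Let $A$ be a real $m\times n$ payoff matrix such that the value of the one-shot matrix game $A$ cannot be obtained by a pure action of Player 2, and let $S$ be an $n\times n$ switching-cost matrix all of whose off-diagonal entries are strictly positive. Let $v$, $\bar v$, $y^*$, $\underline c$ and $\bar c$ be as defined in the context, let $s={y^*}^TSy^*$ and $c_0=\frac{\bar v-v}{s}$. Let $\bar y$ be a pure minimax action of Player 2 in $A$ (viewed as a unit vector), and let $\hat s={y^*}^TS\bar y+\bar y^TSy^*$. If $s>\hat s$, then for every $c\in[c_1,c_2]\cap(\underline c,\bar c)$, where $c_1=\frac{s}{2s-\hat s}c_0$ and $c_2=\frac{s}{\hat s}c_0$, the bound $$\tilde v(c)-v(c)\le\begin{cases}(c-\underline c)\,\dfrac{\bar c-c_0}{\bar c-\underline c}\,s & \text{if } c\in(\underline c,c_0],\\[2mm] (\bar c-c)\,\dfrac{c_0-\underline c}{\bar c-\underline c}\,s & \text{if } c\in(c_0,\bar c)\end{cases}$$ on Player 2's loss from limiting himself to static strategies can be improved by using instead $\tilde v(c)-v(c)\le\Delta(c)$ with $$\Delta(c)=(\bar v-v-\underline c\,s)\,\frac{\bar c-c}{\bar c-\underline c}-\frac{(\bar v-v-c\,\hat s)^2}{4c\,(s-\hat s)}.$$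
   Context: A zero-sum game with switching costs is a tuple $(A,S,c)$ where $A=(a_{ij})$ is a real $m\times n$ matrix, normalized without loss of generality so that its minimal and maximal entries are $0$ and $1$, $c\ge 0$, and $S=(s_{kj})$ is an $n\times n$ matrix (the switching-cost matrix) with $s_{kj}\ge 0$ and $s_{jj}=0$ for all $k,j$, normalized so that its smallest nonzero entry is $1$. At each stage $t=1,2,\dots$, Player 1 (the maximizer) chooses a row $i(t)$ and Player 2 (the minimizer) chooses a column $j(t)$, possibly at random, knowing the history of realized actions. The stage payoff, paid by Player 2 to Player 1, is $u_t=a_{i(t)j(t)}+c\,s_{j(t-1)j(t)}$, with no switching cost paid at $t=1$. For a strategy pair $(\sigma,\tau)$ the payoff is $\gamma(\sigma,\tau)=\mathbb{E}_{\sigma,\tau}\big(\liminf_{T\to\infty}\frac1T\sum_{t=1}^T u_t\big)$. A stationary strategy is one in which the mixed action at stage $t$ depends only on the previous action $j(t-1)$ of Player 2, and not on the rest of the history or on $t$. The game has a value, denoted $v(c)$, attained in stationary strategies. A static strategy plays the same mixed action at every stage regardless of the history. The minimax value in static strategies is $\tilde v(c)=\min_{y\in\Delta(\{1,\dots,n\})}\max_{x\in\Delta(\{1,\dots,m\})}\{x^TAy+c\,y^TSy\}$. Further notation: $v=\min_y\max_x x^TAy$ is the (mixed) value of the one-shot game $A$, and $\bar v=\min_j\max_i a_{ij}$ is its minimax value in pure actions; a pure minimax action is a column $j$ attaining this minimum (if there are several, different choices may give different bounds, and the lowest can be chosen). $\mathcal A$ is the set of optimal mixed actions of Player 2 in the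 one-shot game $A$, and $y^*\in\operatorname{argmin}_{y\in\mathcal A}y^TSy$. $\underline c$ is the maximal number such that $v(c)=\tilde v(c)$ for every $c\in[0,\underline c]$, i.e. such that on this interval the value is attained by some static strategy. $\bar c$ is the threshold such that Player 2's optimal strategy is the pure minimax strategy of the matrix game $A$ for every $c\ge\bar c$, but not for $c<\bar c$ (it exists because all off-diagonal entries of $S$ are positive); hence $v(c)=\tilde v(c)=\bar v$ for $c\ge\bar c$.
   Formalization: $\underline c$ is taken as the maximal number such that one and the same static strategy attains $v(c)=\tilde v(c)$ for all $c\in[0,\underline c]$; if the static strategy may change with $c$, the bound can fail. *)

theory Defs
  imports "HOL-Probability.Probability"
begin

definition mixed :: "(real ^ 'k::finite) set" where
  "mixed = {p. (\<forall>i. 0 \<le> p $ i) \<and> (\<Sum>i\<in>UNIV. p $ i) = 1}"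

text \<open>
  Rows are indexed by \<open>'m\<close> (Player 1, the maximizer) and columns by \<open>'n\<close> (Player 2, the minimizer).
  The entry \<open>S $ k $ j\<close> is the cost of switching from column \<open>k\<close> to column \<open>j\<close>.
\<close>

definition switching_game :: "real ^ 'n::finite ^ 'm::finite \<Rightarrow> real ^ 'n ^ 'n \<Rightarrow> bool" where
  "switching_game A S \<longleftrightarrow>
     (\<forall>i j. 0 \<le> A $ i $ j \<and> A $ i $ j \<le> 1) \<and> (\<exists>i j. A $ i $ j = 0) \<and> (\<exists>i j. A $ i $ j = 1) \<and>
     (\<forall>k j. 0 \<le> S $ k $ j) \<and> (\<forall>j. S $ j $ j = 0) \<and>
     (\<forall>k j. S $ k $ j \<noteq> 0 \<longrightarrow> 1 \<le> S $ k $ j) \<and> (\<exists>k j. S $ k $ j = 1)"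

section \<open>The repeated game\<close>

text \<open>
  A history is the list of realized action pairs, oldest first. Stages are numbered from \<open>0\<close>.
\<close>

type_synonym ('m, 'n) strategy1 = "('m \<times> 'n) list \<Rightarrow> 'm pmf"
type_synonym ('m, 'n) strategy2 = "('m \<times> 'n) list \<Rightarrow> 'n pmf"

definition stage_law ::
  "('m, 'n) strategy1 \<Rightarrow> ('m, 'n) strategy2 \<Rightarrow> nat \<Rightarrow> (nat \<Rightarrow> 'm \<times> 'n) \<Rightarrow> ('m \<times> 'n) measure" where
  "stage_law \<sigma> \<tau> t \<omega> =
     (let h = map \<omega> [0..<t] in measure_pmf (pair_pmf (\<sigma> h) (\<tau> h)))"

text \<open>
  The law of the infinite play: the Ionescu-Tulcea extension of the stage laws to the product
  sigma-algebra. The constants are used through their global names because the library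
  provides them only inside locales; for finite \<open>'m\<close> and \<open>'n\<close> the locale assumptions hold.
\<close>

definition play_measure ::
  "('m, 'n) strategy1 \<Rightarrow> ('m, 'n) strategy2 \<Rightarrow> (nat \<Rightarrow> 'm \<times> 'n) measure" where
  "play_measure \<sigma> \<tau> =
     projective_family.lim UNIV
       (Ionescu_Tulcea.CI (stage_law \<sigma> \<tau>) (\<lambda>_. count_space UNIV)) (\<lambda>_. count_space UNIV)"

definition stage_payoff ::
  "real ^ 'n::finite ^ 'm::finite \<Rightarrow> real ^ 'n ^ 'n \<Rightarrow> real \<Rightarrow> (nat \<Rightarrow> 'm \<times> 'n) \<Rightarrow> nat \<Rightarrow> real" where
  "stage_payoff A S c \<omega> t =
     A $ fst (\<omega> t) $ snd (\<omega> t) + (if t = 0 then 0 else c * S $ snd (\<omega> (t - 1)) $ snd (\<omega> t))"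

text \<open>The averages are bounded, so the extended-real limit inferior is finite.\<close>

definition payoff ::
  "real ^ 'n::finite ^ 'm::finite \<Rightarrow> real ^ 'n ^ 'n \<Rightarrow> real \<Rightarrow>
   ('m, 'n) strategy1 \<Rightarrow> ('m, 'n) strategy2 \<Rightarrow> real" where
  "payoff A S c \<sigma> \<tau> =
     (\<integral>\<omega>. real_of_ereal (liminf (\<lambda>T. ereal ((\<Sum>t<T. stage_payoff A S c \<omega> t) / real T)))
        \<partial>play_measure \<sigma> \<tau>)"

definition game_value :: "real ^ 'n::finite ^ 'm::finite \<Rightarrow> real ^ 'n ^ 'n \<Rightarrow> real \<Rightarrow> real" where
  "game_value A S c =
     (THE w. w = (SUP \<sigma>. INF \<tau>. payoff A S c \<sigma> \<tau>) \<and> w = (INF \<tau>. SUP \<sigma>. payoff A S c \<sigma> \<tau>))"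

definition optimal2 ::
  "real ^ 'n::finite ^ 'm::finite \<Rightarrow> real ^ 'n ^ 'n \<Rightarrow> real \<Rightarrow> ('m, 'n) strategy2 \<Rightarrow> bool" where
  "optimal2 A S c \<tau> \<longleftrightarrow> (\<forall>\<sigma>. payoff A S c \<sigma> \<tau> \<le> game_value A S c)"

section \<open>The one-shot game\<close>

definition worst_case :: "real ^ 'n::finite ^ 'm::finite \<Rightarrow> real ^ 'n \<Rightarrow> real" where
  "worst_case A y = (SUP x\<in>mixed. x \<bullet> (A *v y))"

definition one_shot_value :: "real ^ 'n::finite ^ 'm::finite \<Rightarrow> real" where
  "one_shot_value A = (INF y\<in>mixed. worst_case A y)"

definition optimal_mixed :: "real ^ 'n::finite ^ 'm::finite \<Rightarrow> (real ^ 'n) set" where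
  "optimal_mixed A = {y \<in> mixed. worst_case A y = one_shot_value A}"

definition pure_minimax_value :: "real ^ 'n::finite ^ 'm::finite \<Rightarrow> real" where
  "pure_minimax_value A = (MIN j. MAX i. A $ i $ j)"

definition pure_minimax_action :: "real ^ 'n::finite ^ 'm::finite \<Rightarrow> 'n \<Rightarrow> bool" where
  "pure_minimax_action A j \<longleftrightarrow> (MAX i. A $ i $ j) = pure_minimax_value A"

section \<open>Static strategies and thresholds\<close>

definition static_payoff ::
  "real ^ 'n::finite ^ 'm::finite \<Rightarrow> real ^ 'n ^ 'n \<Rightarrow> real \<Rightarrow> real ^ 'n \<Rightarrow> real" where
  "static_payoff A S c y = (SUP x\<in>mixed. x \<bullet> (A *v y) + c * (y \<bullet> (S *v y)))"

definition static_value :: "real ^ 'n::finite ^ 'm::finite \<Rightarrow> real ^ 'n ^ 'n \<Rightarrow> real \<Rightarrow> real" where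
  "static_value A S c = (INF y\<in>mixed. static_payoff A S c y)"

text \<open>
  The lower threshold is the end of the maximal interval starting at \<open>0\<close> on which the game value
  and the static value coincide and are attained by some static strategy. The static strategy \<open>y\<close>
  is one and the same on the whole interval: if it were allowed to change with \<open>c\<close>, the interval
  could extend past a kink at which the optimal static strategy stops being optimal in the
  one-shot game.
\<close>

definition lower_threshold :: "real ^ 'n::finite ^ 'm::finite \<Rightarrow> real ^ 'n ^ 'n \<Rightarrow> real" where
  "lower_threshold A S =
     (GREATEST d. 0 \<le> d \<and>
        (\<exists>y\<in>mixed. \<forall>c\<in>{0..d}. game_value A S c = static_value A S c \<and>
                              static_payoff A S c y = static_value A S c))"

definition upper_threshold :: "real ^ 'n::finite ^ 'm::finite \<Rightarrow> real ^ 'n ^ 'n \<Rightarrow> 'n \<Rightarrow> real" where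
  "upper_threshold A S j =
     (THE d. 0 \<le> d \<and> (\<forall>c\<ge>0. optimal2 A S c (\<lambda>_. return_pmf j) \<longleftrightarrow> d \<le> c))"

end

theory Submission
  imports Defs "HOL-Library.Discrete_Functions"
begin

text \<open>
  The bound combines a lower bound on the game value with an upper bound on the static value.

  The game value is concave in the cost \<open>c\<close>. To see this, Player 2's behaviour is described by a flow,
  the long-run frequencies of his moves between columns. Player 1 observes the current column, so a
  flow costs Player 2 the sum of Player 1's best replies to the rows of the flow plus \<open>c\<close> times the
  average switching cost, and the value is the infimum of these costs, which are affine in \<open>c\<close>
  (\<open>game_value_eq_flow_value\<close>). Player 2 attains the cost of a flow by running the corresponding
  stationary Markov chain. Conversely, the dual of the flow problem (\<open>flow_value_potentials\<close>) yields
  for each column a mixed action of Player 1 and a potential; by the strong law of large numbers for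
  martingales, playing these actions secures the flow value up to an arbitrarily small error, almost
  surely and not merely in expectation, as is required by the limit inferior inside the expectation.

  At the lower threshold the value is \<open>v + c_lo * s\<close>, and at the upper one it is \<open>vbar\<close>
  (\<open>lower_threshold_properties\<close>, \<open>upper_threshold_properties\<close>). By concavity it lies above the chord
  between these two points.

  For the static value, Player 2 mixes \<open>ystar\<close> with weight \<open>u\<close> and \<open>ybar\<close> with weight \<open>1 - u\<close>. His loss
  is then at most \<open>vbar - u * a + u\<^sup>2 * b\<close> with \<open>a = vbar - v - c * shat\<close> and \<open>b = c * (s - shat)\<close>. Since
  \<open>s > shat\<close> this is convex in \<open>u\<close>, and \<open>c1 \<le> c \<le> c2\<close> says that its minimizer \<open>a / (2 * b)\<close> lies in
  \<open>{0..1}\<close>. The minimum minus the chord is \<open>\<Delta> c\<close>, whereas the original bound is obtained from the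
  weights \<open>u = 1\<close> and \<open>u = 0\<close>. Hence \<open>\<Delta> c\<close> never exceeds it, and is smaller when the minimizer is
  interior.
\<close>

section \<open>The law of finite histories\<close>

lemma Ionescu_Tulcea_stage_law:
  fixes \<sigma> :: "('m::finite, 'n::finite) strategy1" and \<tau> :: "('m, 'n) strategy2"
  shows "Ionescu_Tulcea (stage_law \<sigma> \<tau>) (\<lambda>_. count_space UNIV)"
proof
  fix t :: nat
  have "PiM {0..<t} (\<lambda>_. count_space (UNIV :: ('m \<times> 'n) set)) = count_space (PiE {0..<t} (\<lambda>_. UNIV))"
    by (rule count_space_PiM_finite) auto
  then show "stage_law \<sigma> \<tau> t \<in> PiM {0..<t} (\<lambda>_. count_space UNIV) \<rightarrow>\<^sub>M subprob_algebra (count_space UNIV)"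
    by (auto simp: measurable_count_space_eq1 stage_law_def Let_def measure_pmf_in_subprob_algebra)
qed (auto simp: stage_law_def Let_def measure_pmf.prob_space_axioms)

text \<open>
  The law of the first \<open>t\<close> action pairs has finite support. Working with it instead of the law of
  the infinite play makes every function of a history measurable and integrable.
\<close>

primrec history_law :: "('m, 'n) strategy1 \<Rightarrow> ('m, 'n) strategy2 \<Rightarrow> nat \<Rightarrow> ('m \<times> 'n) list pmf" where
  "history_law \<sigma> \<tau> 0 = return_pmf []"
| "history_law \<sigma> \<tau> (Suc t) =
     bind_pmf (history_law \<sigma> \<tau> t) (\<lambda>h. map_pmf (\<lambda>z. h @ [z]) (pair_pmf (\<sigma> h) (\<tau> h)))"

lemma length_history_law: "h \<in> set_pmf (history_law \<sigma> \<tau> t) \<Longrightarrow> length h = t"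
  by (induction t arbitrary: h) auto

lemma finite_set_history_law:
  fixes \<sigma> :: "('m::finite, 'n::finite) strategy1"
  shows "finite (set_pmf (history_law \<sigma> \<tau> t))"
  by (rule finite_subset[OF _ finite_lists_length_eq[of UNIV t]]) (auto simp: length_history_law)

text \<open>
  The projective limit is consistent with its finite-dimensional marginals, and these satisfy the
  recursion that defines \<^const>\<open>history_law\<close>. That the play measure has total mass 1 is the special
  case of a constant integrand.
\<close>

lemma
  fixes \<sigma> :: "('m::finite, 'n::finite) strategy1" and \<tau> :: "('m, 'n) strategy2"
  shows sets_play_measure [measurable_cong]:
      "sets (play_measure \<sigma> \<tau>) = sets (PiM UNIV (\<lambda>_. count_space UNIV))"
    and prob_space_play_measure: "prob_space (play_measure \<sigma> \<tau>)"
    and nn_integral_play_history: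
      "(\<integral>\<^sup>+\<omega>. G (map \<omega> [0..<t]) \<partial>play_measure \<sigma> \<tau>) = (\<integral>\<^sup>+h. G h \<partial>history_law \<sigma> \<tau> t)"
proof -
  interpret IT: Ionescu_Tulcea "stage_law \<sigma> \<tau>" "\<lambda>_. count_space (UNIV :: ('m \<times> 'n) set)"
    by (rule Ionescu_Tulcea_stage_law)
  have lim: "play_measure \<sigma> \<tau> = IT.PF.lim"
    by (simp add: play_measure_def)
  show sets: "sets (play_measure \<sigma> \<tau>) = sets (PiM UNIV (\<lambda>_. count_space UNIV))"
    by (simp add: lim)
  have PiM: "PiM {0..<t} (\<lambda>_. count_space (UNIV :: ('m \<times> 'n) set)) = count_space (PiE {0..<t} (\<lambda>_. UNIV))" for t :: nat
    by (rule count_space_PiM_finite) auto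
  have meas: "g \<in> borel_measurable (PiM {0..<t} (\<lambda>_. count_space (UNIV :: ('m \<times> 'n) set)))" 
    for g :: "_ \<Rightarrow> ennreal" and t :: nat
    by (simp add: PiM measurable_count_space_eq1)
  have C: "(\<integral>\<^sup>+x. G (map x [0..<t]) \<partial>IT.C 0 t (\<lambda>_. undefined)) = (\<integral>\<^sup>+h. G h \<partial>history_law \<sigma> \<tau> t)"
    for G :: "_ \<Rightarrow> ennreal" and t
  proof (induction t arbitrary: G)
    case 0
    have "(\<lambda>_. undefined) \<in> space (PiM {0..<0::nat} (\<lambda>_. count_space (UNIV :: ('m \<times> 'n) set)))"
      by (simp add: space_PiM)
    then show ?case
      unfolding IT.C.simps history_law.simps by (subst nn_integral_return[OF _ meas]) auto
  next
    case (Suc t)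
    have u: "(\<lambda>_. undefined) \<in> space (PiM {0..<0::nat} (\<lambda>_. count_space (UNIV :: ('m \<times> 'n) set)))"
      by (simp add: space_PiM)
    have "(\<integral>\<^sup>+x. G (map x [0..<Suc t]) \<partial>IT.C 0 (Suc t) (\<lambda>_. undefined)) =
      (\<integral>\<^sup>+x. (\<integral>\<^sup>+y. G (map y [0..<Suc t]) \<partial>IT.eP t x) \<partial>IT.C 0 t (\<lambda>_. undefined))"
      unfolding IT.C.simps
      using IT.sets_C[OF u, of t] IT.measurable_eP[of t]
      by (subst nn_integral_bind[OF meas[of _ "Suc t"]]) (auto cong: measurable_cong_sets simp del: upt_Suc)
    also have "\<dots> = (\<integral>\<^sup>+x. (\<integral>\<^sup>+z. G (map x [0..<t] @ [z]) \<partial>stage_law \<sigma> \<tau> t x) \<partial>IT.C 0 t (\<lambda>_. undefined))"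
    proof (rule nn_integral_cong)
      fix x assume "x \<in> space (IT.C 0 t (\<lambda>_. undefined))"
      then have x: "x \<in> space (PiM {0..<t} (\<lambda>_. count_space (UNIV :: ('m \<times> 'n) set)))"
        using IT.space_C[OF u, of t] by simp
      have "map (x(t := z)) [0..<t] = map x [0..<t]" for z
        by (rule map_cong) auto
      then show "(\<integral>\<^sup>+y. G (map y [0..<Suc t]) \<partial>IT.eP t x) = (\<integral>\<^sup>+z. G (map x [0..<t] @ [z]) \<partial>stage_law \<sigma> \<tau> t x)"
        by (subst IT.nn_integral_eP[OF x meas]) simp
    qed
    also have "\<dots> = (\<integral>\<^sup>+h. (\<integral>\<^sup>+z. G (h @ [z]) \<partial>pair_pmf (\<sigma> h) (\<tau> h)) \<partial>history_law \<sigma> \<tau> t)"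
    proof -
      have st: "stage_law \<sigma> \<tau> t x = measure_pmf (pair_pmf (\<sigma> (map x [0..<t])) (\<tau> (map x [0..<t])))" for x
        by (simp add: stage_law_def Let_def)
      show ?thesis unfolding st by (rule Suc.IH)
    qed
    also have "\<dots> = (\<integral>\<^sup>+h. G h \<partial>history_law \<sigma> \<tau> (Suc t))"
      by simp
    finally show ?case .
  qed
  have "IT.up_to {0..<t} = t"
    using IT.up_to[of "{0..<t}"] by (intro antisym) (auto simp: IT.up_to_iff_Ico)
  then have CI: "IT.CI {0..<t} = distr (IT.C 0 t (\<lambda>_. undefined)) (PiM {0..<t} (\<lambda>_. count_space UNIV)) (\<lambda>f. restrict f {0..<t})"
    by (simp add: IT.CI_def)
  have mr: "map (restrict \<omega> {0..<t}) [0..<t] = map \<omega> [0..<t]" for \<omega> :: "nat \<Rightarrow> 'm \<times> 'n"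
    by (rule map_cong) auto
  have r: "(\<lambda>f. restrict f {0..<t}) \<in> PiM UNIV (\<lambda>_. count_space UNIV) \<rightarrow>\<^sub>M PiM {0..<t} (\<lambda>_. count_space (UNIV :: ('m \<times> 'n) set))"
    by (rule measurable_restrict_subset) simp
  have nn: "(\<integral>\<^sup>+\<omega>. G (map \<omega> [0..<t]) \<partial>play_measure \<sigma> \<tau>) = (\<integral>\<^sup>+h. G h \<partial>history_law \<sigma> \<tau> t)"
    for G :: "_ \<Rightarrow> ennreal"
  proof -
    have "(\<integral>\<^sup>+\<omega>. G (map \<omega> [0..<t]) \<partial>IT.PF.lim) =
      (\<integral>\<^sup>+x. G (map x [0..<t]) \<partial>distr IT.PF.lim (PiM {0..<t} (\<lambda>_. count_space UNIV)) (\<lambda>f. restrict f {0..<t}))"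
      by (subst nn_integral_distr) (use r meas in \<open>auto simp: mr cong: measurable_cong_sets\<close>)
    also have "\<dots> = (\<integral>\<^sup>+x. G (map x [0..<t]) \<partial>IT.CI {0..<t})"
      by (subst IT.distr_lim) auto
    also have "\<dots> = (\<integral>\<^sup>+x. G (map x [0..<t]) \<partial>IT.C 0 t (\<lambda>_. undefined))"
      unfolding CI using IT.sets_C[of "\<lambda>_. undefined" 0 t]
      by (subst nn_integral_distr) (use meas in \<open>auto simp: mr space_PiM cong: measurable_cong_sets intro!: measurable_restrict\<close>)
    finally show ?thesis
      by (simp add: lim C)
  qed
  show "(\<integral>\<^sup>+\<omega>. G (map \<omega> [0..<t]) \<partial>play_measure \<sigma> \<tau>) = (\<integral>\<^sup>+h. G h \<partial>history_law \<sigma> \<tau> t)"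
    by (rule nn)
  from nn[of "\<lambda>_. 1"] show "prob_space (play_measure \<sigma> \<tau>)"
    by (intro prob_spaceI) (simp add: measure_pmf.emeasure_space_1[simplified])
qed

lemma measurable_history [measurable]:
  fixes \<sigma> :: "('m::finite, 'n::finite) strategy1"
  shows "(\<lambda>\<omega>. map \<omega> [0..<t]) \<in> play_measure \<sigma> \<tau> \<rightarrow>\<^sub>M count_space UNIV"
proof (induction t)
  case (Suc t)
  have "(\<lambda>\<omega>. \<omega> t) \<in> play_measure \<sigma> \<tau> \<rightarrow>\<^sub>M count_space UNIV"
    by measurable
  with Suc have "(\<lambda>\<omega>. (map \<omega> [0..<t], \<omega> t)) \<in> play_measure \<sigma> \<tau> \<rightarrow>\<^sub>M count_space UNIV \<Otimes>\<^sub>M count_space UNIV"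
    by (rule measurable_Pair)
  then have "(\<lambda>\<omega>. (map \<omega> [0..<t], \<omega> t)) \<in> play_measure \<sigma> \<tau> \<rightarrow>\<^sub>M count_space UNIV"
    by (simp add: pair_measure_countable)
  from measurable_compose[OF this, of "\<lambda>p. fst p @ [snd p]" "count_space UNIV"]
  have "(\<lambda>\<omega>. map \<omega> [0..<t] @ [\<omega> t]) \<in> play_measure \<sigma> \<tau> \<rightarrow>\<^sub>M count_space UNIV"
    by simp
  then show ?case by simp
qed simp

lemma distr_history:
  fixes \<sigma> :: "('m::finite, 'n::finite) strategy1"
  shows "distr (play_measure \<sigma> \<tau>) (count_space UNIV) (\<lambda>\<omega>. map \<omega> [0..<t]) = history_law \<sigma> \<tau> t"
proof (rule measure_eqI)
  fix X :: "('m \<times> 'n) list set"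
  have "emeasure (distr (play_measure \<sigma> \<tau>) (count_space UNIV) (\<lambda>\<omega>. map \<omega> [0..<t])) X =
      (\<integral>\<^sup>+x. indicator X x \<partial>distr (play_measure \<sigma> \<tau>) (count_space UNIV) (\<lambda>\<omega>. map \<omega> [0..<t]))"
    by (simp add: nn_integral_indicator)
  also have "\<dots> = (\<integral>\<^sup>+\<omega>. indicator X (map \<omega> [0..<t]) \<partial>play_measure \<sigma> \<tau>)"
    by (rule nn_integral_distr) auto
  also have "\<dots> = emeasure (history_law \<sigma> \<tau> t) X"
    by (simp add: nn_integral_play_history)
  finally show "emeasure (distr (play_measure \<sigma> \<tau>) (count_space UNIV) (\<lambda>\<omega>. map \<omega> [0..<t])) X =
      emeasure (history_law \<sigma> \<tau> t) X" .
qed simp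

lemma integrable_history:
  fixes \<sigma> :: "('m::finite, 'n::finite) strategy1" and F :: "_ \<Rightarrow> real"
  shows "integrable (play_measure \<sigma> \<tau>) (\<lambda>\<omega>. F (map \<omega> [0..<t]))"
proof (rule integrable_distr[OF measurable_history])
  show "integrable (distr (play_measure \<sigma> \<tau>) (count_space UNIV) (\<lambda>\<omega>. map \<omega> [0..<t])) F"
    unfolding distr_history by (rule integrable_measure_pmf_finite[OF finite_set_history_law])
qed

lemma integral_history:
  fixes \<sigma> :: "('m::finite, 'n::finite) strategy1" and F :: "_ \<Rightarrow> real"
  shows "(\<integral>\<omega>. F (map \<omega> [0..<t]) \<partial>play_measure \<sigma> \<tau>) = measure_pmf.expectation (history_law \<sigma> \<tau> t) F"
  by (subst distr_history[symmetric], subst integral_distr) auto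

text \<open>
  The tower property: conditioned on the history \<open>h\<close>, the next action pair is drawn from the product
  of the two mixed actions that the strategies prescribe at \<open>h\<close>. All that is used below about the
  dependence between stages goes through this identity.
\<close>

lemma integral_history_Suc:
  fixes \<sigma> :: "('m::finite, 'n::finite) strategy1" and F :: "_ \<Rightarrow> real"
  shows "(\<integral>\<omega>. F (map \<omega> [0..<Suc t]) \<partial>play_measure \<sigma> \<tau>) =
    (\<integral>\<omega>. (let h = map \<omega> [0..<t] in measure_pmf.expectation (pair_pmf (\<sigma> h) (\<tau> h)) (\<lambda>z. F (h @ [z])))
       \<partial>play_measure \<sigma> \<tau>)"
proof -
  let ?H = "history_law \<sigma> \<tau>"
  have "measure_pmf.expectation (?H (Suc t)) F =
    measure_pmf.expectation (?H t) (\<lambda>h. measure_pmf.expectation (map_pmf (\<lambda>z. h @ [z]) (pair_pmf (\<sigma> h) (\<tau> h))) F)"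
    unfolding history_law.simps
    by (subst pmf_expectation_bind[where A="set_pmf (?H t)"])
       (auto simp: finite_set_history_law integral_measure_pmf[OF finite_set_history_law] mult.commute)
  then show ?thesis
    by (simp add: integral_history Let_def integral_history[where F="\<lambda>h. measure_pmf.expectation (pair_pmf (\<sigma> h) (\<tau> h)) (\<lambda>z. F (h @ [z]))"] del: upt_Suc)
qed

section \<open>Limits of long-run averages\<close>

lemma liminf_ereal_bounds:
  fixes f :: "nat \<Rightarrow> real"
  assumes "\<And>n. 0 \<le> f n" "\<And>n. f n \<le> B"
  shows "0 \<le> liminf (\<lambda>n. ereal (f n))" "liminf (\<lambda>n. ereal (f n)) \<le> ereal B"
    "ereal (real_of_ereal (liminf (\<lambda>n. ereal (f n)))) = liminf (\<lambda>n. ereal (f n))"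
proof -
  show *: "0 \<le> liminf (\<lambda>n. ereal (f n))"
    by (rule Liminf_bounded) (use assms in auto)
  show **: "liminf (\<lambda>n. ereal (f n)) \<le> ereal B"
    by (rule order_trans[OF Liminf_le_Limsup Limsup_bounded]) (use assms in auto)
  show "ereal (real_of_ereal (liminf (\<lambda>n. ereal (f n)))) = liminf (\<lambda>n. ereal (f n))"
    using * ** by (intro ereal_real') auto
qed

text \<open>
  Fatou's lemma, in the form needed for a payoff that is the real part of an extended limit
  inferior: the infima over the tails increase to the limit inferior, lie below each later term, and
  are dominated by the common bound.
\<close>

lemma (in prob_space) integral_liminf_le:
  fixes f :: "nat \<Rightarrow> 'a \<Rightarrow> real"
  assumes meas [measurable]: "\<And>n. f n \<in> borel_measurable M"
    and bounds: "\<And>n \<omega>. 0 \<le> f n \<omega>" "\<And>n \<omega>. f n \<omega> \<le> B"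
    and le: "\<And>n. (\<integral>\<omega>. f n \<omega> \<partial>M) \<le> e n" and e: "e \<longlonglongrightarrow> V"
  shows "(\<integral>\<omega>. real_of_ereal (liminf (\<lambda>n. ereal (f n \<omega>))) \<partial>M) \<le> V"
proof -
  define g where "g n \<omega> = (INF m\<in>{n..}. ereal (f m \<omega>))" for n \<omega>
  have g: "0 \<le> g n \<omega>" "g n \<omega> \<le> ereal (f n \<omega>)" for n \<omega>
    unfolding g_def by (auto intro!: INF_greatest INF_lower simp: bounds)
  have g': "ereal (real_of_ereal (g n \<omega>)) = g n \<omega>" for n \<omega>
    using g[of n \<omega>] by (intro ereal_real') (auto simp: ereal_infty_less_eq)
  have real_g: "0 \<le> real_of_ereal (g n \<omega>)" "real_of_ereal (g n \<omega>) \<le> f n \<omega>" for n \<omega>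
  proof -
    show "0 \<le> real_of_ereal (g n \<omega>)"
      by (rule real_of_ereal_pos) (rule g)
    have "ereal (real_of_ereal (g n \<omega>)) \<le> ereal (f n \<omega>)"
      unfolding g' by (rule g)
    then show "real_of_ereal (g n \<omega>) \<le> f n \<omega>" by simp
  qed
  have [measurable]: "(\<lambda>\<omega>. g n \<omega>) \<in> borel_measurable M" for n
    unfolding g_def by measurable
  have lim: "(\<lambda>n. real_of_ereal (g n \<omega>)) \<longlonglongrightarrow> real_of_ereal (liminf (\<lambda>n. ereal (f n \<omega>)))" for \<omega>
  proof (rule lim_real_of_ereal)
    have "incseq (\<lambda>n. g n \<omega>)"
      unfolding g_def by (intro incseq_SucI INF_superset_mono) auto
    from LIMSEQ_SUP[OF this]
    show "(\<lambda>n. g n \<omega>) \<longlonglongrightarrow> ereal (real_of_ereal (liminf (\<lambda>n. ereal (f n \<omega>))))"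
      using liminf_ereal_bounds(3)[of "\<lambda>n. f n \<omega>" B] bounds
      by (simp add: liminf_SUP_INF g_def)
  qed
  have "(\<lambda>n. \<integral>\<omega>. real_of_ereal (g n \<omega>) \<partial>M)
      \<longlonglongrightarrow> (\<integral>\<omega>. real_of_ereal (liminf (\<lambda>n. ereal (f n \<omega>))) \<partial>M)"
  proof (rule integral_dominated_convergence[where w="\<lambda>_. B"])
    show "AE \<omega> in M. norm (real_of_ereal (g n \<omega>)) \<le> B" for n
      using real_g(1) order_trans[OF real_g(2) bounds(2)]
      by (intro AE_I2) (simp only: real_norm_def abs_of_nonneg)
  qed (auto intro: lim)
  moreover have "(\<integral>\<omega>. real_of_ereal (g n \<omega>) \<partial>M) \<le> e n" for n
  proof (rule order_trans[OF integral_mono le])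
    show "integrable M (f n)"
      using bounds by (intro integrable_const_bound[where B=B]) auto
    show "integrable M (\<lambda>\<omega>. real_of_ereal (g n \<omega>))"
      using real_g order_trans[OF real_g(2) bounds(2)]
      by (intro integrable_const_bound[where B=B] AE_I2)
         (simp_all only: real_norm_def abs_of_nonneg, measurable)
  qed (use real_g in auto)
  ultimately show ?thesis
    using e by (auto intro: LIMSEQ_le)
qed

text \<open>
  Consecutive squares are so close that averages of a bounded sequence hardly change between them:
  from \<open>n\<^sup>2\<close> to \<open>(n + 1)\<^sup>2\<close> there are at most \<open>2 n\<close> further terms, which is negligible against \<open>n\<^sup>2\<close>.
  Along squares a variance of order \<open>1 / T\<close> becomes summable.
\<close>

lemma cesaro_of_square_subsequence:
  fixes x :: "nat \<Rightarrow> real"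
  assumes bounded: "\<And>t. \<bar>x t\<bar> \<le> K"
    and squares: "(\<lambda>n. (\<Sum>t<n\<^sup>2. x t) / (real n)\<^sup>2) \<longlonglongrightarrow> 0"
  shows "(\<lambda>T. (\<Sum>t<T. x t) / real T) \<longlonglongrightarrow> 0"
proof -
  have K: "0 \<le> K" using bounded[of 0] by linarith
  have fs: "filterlim floor_sqrt at_top sequentially"
    unfolding filterlim_at_top
  proof
    fix Z show "eventually (\<lambda>n. Z \<le> floor_sqrt n) sequentially"
      unfolding eventually_sequentially
      by (intro exI[of _ "Z\<^sup>2"]) (metis floor_sqrt_inverse_power2 mono_floor_sqrt')
  qed
  have bnd: "\<bar>(\<Sum>t<T. x t) / real T\<bar> \<le>
    \<bar>(\<Sum>t<(floor_sqrt T)\<^sup>2. x t) / (real (floor_sqrt T))\<^sup>2\<bar> + 2 * K / real (floor_sqrt T)" if "0 < T" for T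
  proof -
    let ?n = "floor_sqrt T"
    have n: "0 < ?n" using that by simp
    have nT: "?n\<^sup>2 \<le> T" "T \<le> ?n\<^sup>2 + 2 * ?n"
      using floor_sqrt_power2_le[of T] Suc_floor_sqrt_power2_gt[of T] by (auto simp: power2_eq_square)
    have "(\<Sum>t<T. x t) = (\<Sum>t<?n\<^sup>2. x t) + (\<Sum>t\<in>{?n\<^sup>2..<T}. x t)"
      using nT(1) by (metis atLeast0LessThan sum.atLeastLessThan_concat zero_le)
    moreover have "\<bar>\<Sum>t\<in>{?n\<^sup>2..<T}. x t\<bar> \<le> real (T - ?n\<^sup>2) * K"
      using order_trans[OF sum_abs[of x "{?n\<^sup>2..<T}"] sum_bounded_above[of "{?n\<^sup>2..<T}" "\<lambda>t. \<bar>x t\<bar>" K]] bounded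
      by (simp del: of_nat_diff)
    moreover have "real (T - ?n\<^sup>2) * K \<le> real (2 * ?n) * K"
      using nT K by (intro mult_right_mono of_nat_mono) auto
    ultimately have "\<bar>\<Sum>t<T. x t\<bar> \<le> \<bar>\<Sum>t<?n\<^sup>2. x t\<bar> + 2 * real ?n * K"
      by simp
    then have "\<bar>(\<Sum>t<T. x t) / real T\<bar> \<le> (\<bar>\<Sum>t<?n\<^sup>2. x t\<bar> + 2 * real ?n * K) / real T"
      using that by (simp add: divide_right_mono)
    also have "\<dots> \<le> (\<bar>\<Sum>t<?n\<^sup>2. x t\<bar> + 2 * real ?n * K) / (real ?n)\<^sup>2"
    proof (rule divide_left_mono)
      show "(real ?n)\<^sup>2 \<le> real T"
        using of_nat_mono[OF nT(1), where 'a=real] by simp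
      show "0 \<le> \<bar>\<Sum>t<?n\<^sup>2. x t\<bar> + 2 * real ?n * K"
        using K by simp
      show "0 < real T * (real ?n)\<^sup>2"
        using n that by simp
    qed
    also have "\<dots> = \<bar>(\<Sum>t<?n\<^sup>2. x t) / (real ?n)\<^sup>2\<bar> + 2 * K / real ?n"
      using n by (simp add: add_divide_distrib power2_eq_square)
    finally show ?thesis .
  qed
  have "((\<lambda>n. 2 * K / real n) \<longlongrightarrow> 0) sequentially"
    by (rule lim_const_over_n)
  then have "(\<lambda>n. \<bar>(\<Sum>t<n\<^sup>2. x t) / (real n)\<^sup>2\<bar> + 2 * K / real n) \<longlonglongrightarrow> \<bar>0\<bar> + 0"
    by (intro tendsto_add tendsto_rabs squares)
  from filterlim_compose[OF this fs]
  have lim: "(\<lambda>T. \<bar>(\<Sum>t<(floor_sqrt T)\<^sup>2. x t) / (real (floor_sqrt T))\<^sup>2\<bar> + 2 * K / real (floor_sqrt T)) \<longlonglongrightarrow> 0"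
    by simp
  show ?thesis
    by (rule Lim_null_comparison[OF _ lim])
       (use bnd in \<open>auto intro!: eventually_mono[OF eventually_gt_at_top[of 0]]\<close>)
qed

text \<open>
  A strong law of large numbers for bounded martingale differences. Differences are orthogonal, so
  the second moment of their partial sum grows at most linearly; hence the squared averages along the
  times \<open>n\<^sup>2\<close> have summable expectations, and therefore tend to \<open>0\<close> almost surely.
\<close>

lemma history_martingale_average_tendsto_0:
  fixes \<sigma> :: "('m::finite, 'n::finite) strategy1" and D :: "('m \<times> 'n) list \<Rightarrow> real"
  assumes centred: "\<And>h. measure_pmf.expectation (pair_pmf (\<sigma> h) (\<tau> h)) (\<lambda>z. D (h @ [z])) = 0"
    and bounded: "\<And>l. \<bar>D l\<bar> \<le> K"
  shows "AE \<omega> in play_measure \<sigma> \<tau>. (\<lambda>T. (\<Sum>t<T. D (map \<omega> [0..<Suc t])) / real T) \<longlonglongrightarrow> 0"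
proof -
  interpret prob_space "play_measure \<sigma> \<tau>" by (rule prob_space_play_measure)
  let ?P = "play_measure \<sigma> \<tau>"
  define H where "H l = (\<Sum>t<length l. D (take (Suc t) l))" for l :: "('m \<times> 'n) list"
  define M where "M T \<omega> = (\<Sum>t<T. D (map \<omega> [0..<Suc t]))" for T and \<omega> :: "nat \<Rightarrow> 'm \<times> 'n"
  have M_H: "M T \<omega> = H (map \<omega> [0..<T])" for T \<omega>
    unfolding M_def H_def by (intro sum.cong) (auto simp: take_map simp del: upt_Suc)
  have M_meas [measurable]: "M T \<in> borel_measurable ?P" for T
    using integrable_history[of \<sigma> \<tau> H T, THEN borel_measurable_integrable] by (simp add: M_H[abs_def])
  have K: "0 \<le> K" using bounded[of "[]"] by linarith
  have int_M2: "integrable ?P (\<lambda>\<omega>. (M T \<omega>)\<^sup>2)" for T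
    using integrable_history[of \<sigma> \<tau> "\<lambda>l. (H l)\<^sup>2" T] by (simp add: M_H)
  have second_moment: "(\<integral>\<omega>. (M T \<omega>)\<^sup>2 \<partial>?P) \<le> K\<^sup>2 * real T" for T
  proof (induction T)
    case 0 then show ?case by (simp add: M_def)
  next
    case (Suc T)
    have "(\<integral>\<omega>. (M (Suc T) \<omega>)\<^sup>2 \<partial>?P) =
      (\<integral>\<omega>. (let h = map \<omega> [0..<T] in
          measure_pmf.expectation (pair_pmf (\<sigma> h) (\<tau> h)) (\<lambda>z. (H (h @ [z]))\<^sup>2)) \<partial>?P)"
      unfolding M_H by (rule integral_history_Suc)
    also have "\<dots> \<le> (\<integral>\<omega>. (M T \<omega>)\<^sup>2 + K\<^sup>2 \<partial>?P)"
    proof (rule integral_mono)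
      show "integrable ?P (\<lambda>\<omega>. (let h = map \<omega> [0..<T] in
          measure_pmf.expectation (pair_pmf (\<sigma> h) (\<tau> h)) (\<lambda>z. (H (h @ [z]))\<^sup>2)))"
        unfolding Let_def by (rule integrable_history[where F="\<lambda>h. measure_pmf.expectation (pair_pmf (\<sigma> h) (\<tau> h)) (\<lambda>z. (H (h @ [z]))\<^sup>2)"])
      show "integrable ?P (\<lambda>\<omega>. (M T \<omega>)\<^sup>2 + K\<^sup>2)"
        using int_M2 by simp
      fix \<omega> :: "nat \<Rightarrow> 'm \<times> 'n"
      define h where "h = map \<omega> [0..<T]"
      let ?p = "pair_pmf (\<sigma> h) (\<tau> h)"
      have int [simp]: "integrable (measure_pmf ?p) f" for f :: "_ \<Rightarrow> real"
        by (rule integrable_measure_pmf_finite) simp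
      have H_snoc: "H (h @ [z]) = H h + D (h @ [z])" for z
        unfolding H_def by simp
      have "measure_pmf.expectation ?p (\<lambda>z. (H (h @ [z]))\<^sup>2) =
        measure_pmf.expectation ?p (\<lambda>z. (H h)\<^sup>2 + 2 * H h * D (h @ [z]) + (D (h @ [z]))\<^sup>2)"
        unfolding H_snoc by (simp add: power2_sum algebra_simps)
      also have "\<dots> = (H h)\<^sup>2 + measure_pmf.expectation ?p (\<lambda>z. (D (h @ [z]))\<^sup>2)"
        using centred[of h] by (simp add: measure_pmf.prob_space[simplified])
      also have "\<dots> \<le> (H h)\<^sup>2 + K\<^sup>2"
        using bounded by (intro add_left_mono measure_pmf.integral_le_const) (auto simp: power2_le_iff_abs_le[OF K])
      finally show "(let h = map \<omega> [0..<T] in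
          measure_pmf.expectation (pair_pmf (\<sigma> h) (\<tau> h)) (\<lambda>z. (H (h @ [z]))\<^sup>2)) \<le> (M T \<omega>)\<^sup>2 + K\<^sup>2"
        by (simp add: h_def M_H Let_def)
    qed
    also have "\<dots> = (\<integral>\<omega>. (M T \<omega>)\<^sup>2 \<partial>?P) + K\<^sup>2"
      using int_M2 by (simp add: prob_space)
    also have "\<dots> \<le> K\<^sup>2 * real (Suc T)"
      using Suc by (simp add: distrib_left)
    finally show ?case .
  qed
  define a where "a n \<omega> = (M ((Suc n)\<^sup>2) \<omega> / (real (Suc n))\<^sup>2)\<^sup>2" for n \<omega>
  have a_le: "(\<integral>\<^sup>+\<omega>. ennreal (a n \<omega>) \<partial>?P) \<le> ennreal (K\<^sup>2 * (1 / (real (Suc n))\<^sup>2))" for n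
  proof -
    define r where "r = real (Suc n)"
    have r: "0 < r" "real ((Suc n)\<^sup>2) = r\<^sup>2"
      by (simp_all only: r_def of_nat_power of_nat_0_less_iff zero_less_Suc)
    have a: "a n = (\<lambda>\<omega>. (M ((Suc n)\<^sup>2) \<omega>)\<^sup>2 / (r\<^sup>2)\<^sup>2)"
      by (simp only: a_def[abs_def] power_divide r_def)
    have "(\<integral>\<omega>. a n \<omega> \<partial>?P) = (\<integral>\<omega>. (M ((Suc n)\<^sup>2) \<omega>)\<^sup>2 \<partial>?P) / (r\<^sup>2)\<^sup>2"
      unfolding a by simp
    also have "\<dots> \<le> K\<^sup>2 * r\<^sup>2 / (r\<^sup>2)\<^sup>2"
      using second_moment[of "(Suc n)\<^sup>2"] unfolding r(2) by (intro divide_right_mono) auto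
    also have "\<dots> = K\<^sup>2 * (1 / r\<^sup>2)"
      using r(1) by (simp add: power2_eq_square)
    finally have "ennreal (\<integral>\<omega>. a n \<omega> \<partial>?P) \<le> ennreal (K\<^sup>2 * (1 / r\<^sup>2))"
      by (rule ennreal_leI)
    moreover have "(\<integral>\<^sup>+\<omega>. ennreal (a n \<omega>) \<partial>?P) = ennreal (\<integral>\<omega>. a n \<omega> \<partial>?P)"
    proof (rule nn_integral_eq_integral)
      show "integrable ?P (a n)" unfolding a using int_M2 by simp
      show "AE \<omega> in ?P. 0 \<le> a n \<omega>" unfolding a by simp
    qed
    ultimately show ?thesis unfolding r_def by simp
  qed
  have "(\<lambda>n. 1 / (real (Suc n))\<^sup>2) sums (pi\<^sup>2 / 6)"
    using inverse_squares_sums by (simp only: of_nat_power Suc_eq_plus1)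
  then have summ: "summable (\<lambda>n. K\<^sup>2 * (1 / (real (Suc n))\<^sup>2))"
    by (intro summable_mult) (rule sums_summable)
  have [measurable]: "a n \<in> borel_measurable ?P" for n
    unfolding a_def[abs_def] by measurable
  have "(\<integral>\<^sup>+\<omega>. (\<Sum>n. ennreal (a n \<omega>)) \<partial>?P) = (\<Sum>n. \<integral>\<^sup>+\<omega>. ennreal (a n \<omega>) \<partial>?P)"
    by (rule nn_integral_suminf) simp
  also have "\<dots> \<le> (\<Sum>n. ennreal (K\<^sup>2 * (1 / (real (Suc n))\<^sup>2)))"
    by (rule suminf_le[OF a_le]) auto
  also have "\<dots> = ennreal (\<Sum>n. K\<^sup>2 * (1 / (real (Suc n))\<^sup>2))"
    by (rule suminf_ennreal2[OF _ summ]) simp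
  finally have "(\<integral>\<^sup>+\<omega>. (\<Sum>n. ennreal (a n \<omega>)) \<partial>?P) \<noteq> \<infinity>"
    by (auto simp: top_unique)
  then have "AE \<omega> in ?P. (\<Sum>n. ennreal (a n \<omega>)) \<noteq> \<infinity>"
    by (intro nn_integral_PInf_AE) auto
  then show ?thesis
  proof eventually_elim
    fix \<omega> assume "(\<Sum>n. ennreal (a n \<omega>)) \<noteq> \<infinity>"
    then have "summable (\<lambda>n. a n \<omega>)"
      by (intro summable_suminf_not_top) (simp_all add: a_def)
    then have "(\<lambda>n. a n \<omega>) \<longlonglongrightarrow> 0"
      by (rule summable_LIMSEQ_zero)
    from tendsto_real_sqrt[OF this] have "(\<lambda>n. sqrt (a n \<omega>)) \<longlonglongrightarrow> 0"
      by (simp only: real_sqrt_zero)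
    then have "(\<lambda>n. \<bar>M ((Suc n)\<^sup>2) \<omega> / (real (Suc n))\<^sup>2\<bar>) \<longlonglongrightarrow> 0"
      unfolding a_def real_sqrt_abs .
    then have "(\<lambda>n. M ((Suc n)\<^sup>2) \<omega> / (real (Suc n))\<^sup>2) \<longlonglongrightarrow> 0"
      by (rule tendsto_rabs_zero_cancel)
    then have "(\<lambda>n. M (n\<^sup>2) \<omega> / (real n)\<^sup>2) \<longlonglongrightarrow> 0"
      by (rule LIMSEQ_imp_Suc)
    then show "(\<lambda>T. (\<Sum>t<T. D (map \<omega> [0..<Suc t])) / real T) \<longlonglongrightarrow> 0"
      unfolding M_def by (intro cesaro_of_square_subsequence[OF bounded])
  qed
qed

section \<open>Mixed actions and best replies\<close>

definition mixed_pmf :: "real ^ 'k::finite \<Rightarrow> 'k pmf" where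
  "mixed_pmf p = embed_pmf (\<lambda>i. p $ i)"

lemma pmf_mixed_pmf: "p \<in> mixed \<Longrightarrow> pmf (mixed_pmf p) i = p $ i"
  unfolding mixed_pmf_def mixed_def
  by (rule pmf_embed_pmf) (auto simp: nn_integral_count_space_finite)

lemma expectation_pair_pmf:
  fixes p :: "'a::finite pmf" and q :: "'b::finite pmf" and f :: "'a \<times> 'b \<Rightarrow> real"
  shows "measure_pmf.expectation (pair_pmf p q) f = (\<Sum>i\<in>UNIV. \<Sum>j\<in>UNIV. pmf p i * (pmf q j * f (i, j)))"
proof -
  have "measure_pmf.expectation (pair_pmf p q) f = (\<Sum>z\<in>UNIV \<times> UNIV. pmf (pair_pmf p q) z * f z)"
    by (subst integral_measure_pmf[of UNIV]) auto
  also have "\<dots> = (\<Sum>i\<in>UNIV. \<Sum>j\<in>UNIV. pmf p i * (pmf q j * f (i, j)))"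
    unfolding sum.cartesian_product by (rule sum.cong) (auto simp: pmf_pair mult.assoc)
  finally show ?thesis .
qed

lemma sum_pmf_UNIV: "(\<Sum>i\<in>UNIV. pmf p i) = 1" for p :: "'a::finite pmf"
  by (rule sum_pmf_eq_1) auto

text \<open>
  Player 1's best payoff against a column vector of arbitrary total mass. Homogeneity makes it
  possible to use the mass that a flow moves out of one column directly, without conditioning on
  that column.
\<close>

definition best_reply :: "real ^ 'n::finite ^ 'm::finite \<Rightarrow> real ^ 'n \<Rightarrow> real" where
  "best_reply A z = (MAX i. (A *v z) $ i)"

lemma best_reply_ge: "(A *v z) $ i \<le> best_reply A z"
  unfolding best_reply_def by (rule Max_ge) auto

lemma best_reply_le_iff: "best_reply A z \<le> B \<longleftrightarrow> (\<forall>i. (A *v z) $ i \<le> B)"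
  unfolding best_reply_def by (subst Max_le_iff) auto

lemma best_reply_attained: obtains i where "best_reply A z = (A *v z) $ i"
proof -
  have "best_reply A z \<in> range (\<lambda>i. (A *v z) $ i)"
    unfolding best_reply_def by (rule Max_in) auto
  then show ?thesis using that by auto
qed

lemma best_reply_scaleR: "0 \<le> a \<Longrightarrow> best_reply A (a *\<^sub>R z) = a * best_reply A z"
proof (rule antisym)
  assume a: "0 \<le> a"
  show "best_reply A (a *\<^sub>R z) \<le> a * best_reply A z"
    unfolding best_reply_le_iff
    using a by (auto simp: matrix_vector_mult_scaleR intro!: mult_left_mono best_reply_ge)
  obtain i where "best_reply A z = (A *v z) $ i" by (rule best_reply_attained)
  then show "a * best_reply A z \<le> best_reply A (a *\<^sub>R z)"
    using best_reply_ge[of A "a *\<^sub>R z" i] by (simp add: matrix_vector_mult_scaleR)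
qed

lemma best_reply_add: "best_reply A (x + y) \<le> best_reply A x + best_reply A y"
  unfolding best_reply_le_iff
  by (auto simp: matrix_vector_right_distrib intro!: add_mono best_reply_ge)

lemma best_reply_sum: "finite K \<Longrightarrow> best_reply A (\<Sum>k\<in>K. f k) \<le> (\<Sum>k\<in>K. best_reply A (f k))"
proof (induction K rule: finite_induct)
  case empty
  show ?case by (simp add: best_reply_le_iff)
next
  case (insert k K)
  then show ?case using best_reply_add[of A "f k" "sum f K"] by auto
qed

lemma axis_in_mixed: "axis i 1 \<in> (mixed :: (real ^ 'k::finite) set)"
  by (auto simp: mixed_def axis_def if_distrib cong: if_cong)

lemma SUP_mixed_eq_Max:
  fixes z :: "real ^ 'm::finite"
  shows "(SUP x\<in>mixed. x \<bullet> z + r) = (MAX i. z $ i) + r"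
proof (rule cSup_eq_maximum)
  have "(MAX i. z $ i) \<in> range (($) z)" by (rule Max_in) auto
  then obtain i where i: "(MAX i. z $ i) = z $ i" by (rule rangeE)
  show "(MAX i. z $ i) + r \<in> (\<lambda>x. x \<bullet> z + r) ` mixed"
    by (rule rev_image_eqI[OF axis_in_mixed[of i]]) (simp add: i inner_axis')
next
  fix b assume "b \<in> (\<lambda>x. x \<bullet> z + r) ` mixed"
  then obtain x where x: "x \<in> mixed" "b = x \<bullet> z + r" by auto
  have "x \<bullet> z = (\<Sum>i\<in>UNIV. x $ i * z $ i)"
    by (simp add: inner_vec_def)
  also have "\<dots> \<le> (\<Sum>i\<in>UNIV. x $ i * (MAX i. z $ i))"
    using x by (intro sum_mono mult_left_mono Max_ge) (auto simp: mixed_def)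
  also have "\<dots> = (MAX i. z $ i)"
    using x by (simp add: sum_distrib_right[symmetric] mixed_def)
  finally show "b \<le> (MAX i. z $ i) + r" by (simp add: x)
qed

lemma worst_case_eq_best_reply: "worst_case A y = best_reply A y"
  using SUP_mixed_eq_Max[of "A *v y" 0] by (simp add: worst_case_def best_reply_def)

lemma static_payoff_eq: "static_payoff A S c y = best_reply A y + c * (y \<bullet> (S *v y))"
  unfolding static_payoff_def best_reply_def by (rule SUP_mixed_eq_Max)

section \<open>Bounds on the payoff of a strategy pair\<close>

definition history_payoff ::
  "real ^ 'n::finite ^ 'm::finite \<Rightarrow> real ^ 'n ^ 'n \<Rightarrow> real \<Rightarrow> ('m \<times> 'n) list \<Rightarrow> 'm \<times> 'n \<Rightarrow> real" where
  "history_payoff A S c h z =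
     A $ fst z $ snd z + (if h = [] then 0 else c * S $ snd (last h) $ snd z)"

lemma stage_payoff_history:
  "stage_payoff A S c \<omega> t = history_payoff A S c (map \<omega> [0..<t]) (\<omega> t)"
  by (cases t) (auto simp: stage_payoff_def history_payoff_def)

lemma stage_payoff_history':
  "stage_payoff A S c \<omega> t =
     (\<lambda>l. history_payoff A S c (butlast l) (last l)) (map \<omega> [0..<Suc t])"
  by (simp add: stage_payoff_history)

context
  fixes A :: "real ^ 'n::finite ^ 'm::finite" and S :: "real ^ 'n ^ 'n" and c :: real
  assumes game: "switching_game A S" and c_nonneg: "0 \<le> c"
begin

definition payoff_bound :: real where
  "payoff_bound = 1 + c * (\<Sum>k\<in>UNIV. \<Sum>j\<in>UNIV. S $ k $ j)"

lemma history_payoff_bounds: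
  "0 \<le> history_payoff A S c h z" "history_payoff A S c h z \<le> payoff_bound"
proof -
  have S: "0 \<le> S $ k $ j" for k j using game by (auto simp: switching_game_def)
  have A: "0 \<le> A $ i $ j" "A $ i $ j \<le> 1" for i j using game by (auto simp: switching_game_def)
  show "0 \<le> history_payoff A S c h z"
    using S A c_nonneg by (simp add: history_payoff_def)
  have "S $ k $ j \<le> (\<Sum>k\<in>UNIV. \<Sum>j\<in>UNIV. S $ k $ j)" for k j
    by (rule order_trans[OF member_le_sum[of j UNIV "\<lambda>j. S $ k $ j"]
          member_le_sum[of k UNIV "\<lambda>k. \<Sum>j\<in>UNIV. S $ k $ j"]]) (auto simp: S sum_nonneg)
  then have "c * S $ snd (last h) $ snd z \<le> c * (\<Sum>k\<in>UNIV. \<Sum>j\<in>UNIV. S $ k $ j)"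
    using c_nonneg by (intro mult_left_mono)
  moreover have "0 \<le> c * (\<Sum>k\<in>UNIV. \<Sum>j\<in>UNIV. S $ k $ j)"
    using c_nonneg S by (intro mult_nonneg_nonneg sum_nonneg) auto
  ultimately show "history_payoff A S c h z \<le> payoff_bound"
    using A(2)[of "fst z" "snd z"] by (auto simp: history_payoff_def payoff_bound_def)
qed

lemma stage_payoff_bounds: "0 \<le> stage_payoff A S c \<omega> t" "stage_payoff A S c \<omega> t \<le> payoff_bound"
  unfolding stage_payoff_history by (rule history_payoff_bounds)+

lemma payoff_bound_nonneg: "0 \<le> payoff_bound"
  using history_payoff_bounds order_trans by blast

lemma average_bounds:
  "0 \<le> (\<Sum>t<T. stage_payoff A S c \<omega> t) / real T"
  "(\<Sum>t<T. stage_payoff A S c \<omega> t) / real T \<le> payoff_bound"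
proof -
  show "0 \<le> (\<Sum>t<T. stage_payoff A S c \<omega> t) / real T"
    by (intro divide_nonneg_nonneg sum_nonneg stage_payoff_bounds) auto
  have "(\<Sum>t<T. stage_payoff A S c \<omega> t) \<le> real T * payoff_bound"
    using sum_bounded_above[of "{..<T}" "stage_payoff A S c \<omega>" payoff_bound] stage_payoff_bounds by simp
  then show "(\<Sum>t<T. stage_payoff A S c \<omega> t) / real T \<le> payoff_bound"
    using payoff_bound_nonneg by (cases "T = 0") (auto simp: field_simps)
qed

lemma integrable_stage_payoff: "integrable (play_measure \<sigma> \<tau>) (\<lambda>\<omega>. stage_payoff A S c \<omega> t)"
  unfolding stage_payoff_history' by (rule integrable_history)

lemma measurable_average [measurable]:
  "(\<lambda>\<omega>. (\<Sum>t<T. stage_payoff A S c \<omega> t) / real T) \<in> borel_measurable (play_measure \<sigma> \<tau>)"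
  using borel_measurable_integrable[OF integrable_stage_payoff] by measurable

lemma integral_stage_payoff_le_bound: "(\<integral>\<omega>. stage_payoff A S c \<omega> t \<partial>play_measure \<sigma> \<tau>) \<le> payoff_bound"
  by (rule prob_space.integral_le_const[OF prob_space_play_measure integrable_stage_payoff])
     (simp add: stage_payoff_bounds)

lemma payoff_nonneg: "0 \<le> payoff A S c \<sigma> \<tau>"
  unfolding payoff_def
  by (intro integral_nonneg_AE AE_I2 real_of_ereal_pos liminf_ereal_bounds(1)[OF average_bounds])

text \<open>
  For an upper bound, expected stage payoffs suffice, because the expectation of a limit inferior
  is at most the limit of expectations. The first stage is exempt, as a single stage does not
  matter in the long run.
\<close>

lemma payoff_le:
  assumes "\<And>t. 0 < t \<Longrightarrow> (\<integral>\<omega>. stage_payoff A S c \<omega> t \<partial>play_measure \<sigma> \<tau>) \<le> V"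
  shows "payoff A S c \<sigma> \<tau> \<le> V"
proof -
  interpret prob_space "play_measure \<sigma> \<tau>" by (rule prob_space_play_measure)
  have "0 \<le> (\<integral>\<omega>. stage_payoff A S c \<omega> 1 \<partial>play_measure \<sigma> \<tau>)"
    by (intro integral_nonneg_AE AE_I2 stage_payoff_bounds)
  with assms[of 1] have V: "0 \<le> V" by simp
  have sum_le: "(\<Sum>t<T. \<integral>\<omega>. stage_payoff A S c \<omega> t \<partial>play_measure \<sigma> \<tau>) \<le> payoff_bound + V * real T" for T
  proof (induction T)
    case 0 then show ?case by (simp add: payoff_bound_nonneg)
  next
    case (Suc T)
    show ?case
    proof (cases "T = 0")
      case True
      then show ?thesis using integral_stage_payoff_le_bound[of \<sigma> \<tau> 0] V by simp
    next
      case False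
      then show ?thesis using Suc assms[of T] by (simp add: distrib_left)
    qed
  qed
  have le: "(\<integral>\<omega>. (\<Sum>t<T. stage_payoff A S c \<omega> t) / real T \<partial>play_measure \<sigma> \<tau>) \<le> payoff_bound / real T + V" for T
  proof (cases "T = 0")
    case False
    have "(\<integral>\<omega>. (\<Sum>t<T. stage_payoff A S c \<omega> t) / real T \<partial>play_measure \<sigma> \<tau>) =
      (\<Sum>t<T. \<integral>\<omega>. stage_payoff A S c \<omega> t \<partial>play_measure \<sigma> \<tau>) / real T"
      by (simp add: integrable_stage_payoff)
    also have "\<dots> \<le> (payoff_bound + V * real T) / real T"
      by (intro divide_right_mono sum_le) simp
    finally show ?thesis using False by (simp add: add_divide_distrib)
  qed (use V in simp)
  have "(\<lambda>T. payoff_bound / real T + V) \<longlonglongrightarrow> 0 + V"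
    by (intro tendsto_add lim_const_over_n tendsto_const)
  then show ?thesis
    unfolding payoff_def
    by (intro integral_liminf_le[OF measurable_average average_bounds le]) simp
qed

lemma payoff_le_bound: "payoff A S c \<sigma> \<tau> \<le> payoff_bound"
  by (rule payoff_le) (rule integral_stage_payoff_le_bound)

text \<open>
  For a lower bound, expectations do not suffice and an almost sure argument is needed. If the stage
  payoff, corrected by the increment of a potential \<open>\<phi>\<close> of Player 2's current column, has conditional
  expectation at least \<open>V\<close>, then the sum of the payoffs exceeds \<open>V T\<close> up to a martingale and up to a
  telescoping sum of potentials. The martingale is negligible by the strong law, the telescoping sum
  because it is bounded.
\<close>

lemma payoff_ge:
  fixes \<phi> :: "'n \<Rightarrow> real"
  assumes drift: "\<And>h. h \<noteq> [] \<Longrightarrow> V \<le> measure_pmf.expectation (pair_pmf (\<sigma> h) (\<tau> h))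
      (\<lambda>z. history_payoff A S c h z + \<phi> (snd z) - \<phi> (snd (last h)))"
  shows "V \<le> payoff A S c \<sigma> \<tau>"
proof -
  interpret prob_space "play_measure \<sigma> \<tau>" by (rule prob_space_play_measure)
  define X where "X h z = history_payoff A S c h z + \<phi> (snd z) - \<phi> (snd (last h))" for h and z :: "'m \<times> 'n"
  define e where "e h = measure_pmf.expectation (pair_pmf (\<sigma> h) (\<tau> h)) (X h)" for h
  \<comment> \<open>The drift assumption says nothing about the empty history, so the first difference is set to 0.\<close>
  define D where "D l = (if length l \<le> 1 then 0 else X (butlast l) (last l) - e (butlast l))" for l
  define \<Phi> where "\<Phi> = (\<Sum>j\<in>UNIV. \<bar>\<phi> j\<bar>)"
  have int [simp]: "integrable (measure_pmf (pair_pmf (\<sigma> h) (\<tau> h))) f" for h and f :: "_ \<Rightarrow> real"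
    by (rule integrable_measure_pmf_finite) simp
  have \<phi>: "\<bar>\<phi> j\<bar> \<le> \<Phi>" for j
    unfolding \<Phi>_def by (rule member_le_sum) auto
  have X: "\<bar>X h z\<bar> \<le> payoff_bound + 2 * \<Phi>" for h z
    using history_payoff_bounds[of h z] \<phi>[of "snd z"] \<phi>[of "snd (last h)"] unfolding X_def by linarith
  have e: "\<bar>e h\<bar> \<le> payoff_bound + 2 * \<Phi>" for h
  proof -
    have "e h \<le> payoff_bound + 2 * \<Phi>" "- (payoff_bound + 2 * \<Phi>) \<le> e h"
      unfolding e_def using X[of h, THEN abs_le_D1] X[of h, THEN abs_le_D2, THEN minus_le_iff[THEN iffD1]]
      by (intro measure_pmf.integral_le_const measure_pmf.integral_ge_const int AE_I2; blast)+
    then show ?thesis by simp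
  qed
  have D: "\<bar>D l\<bar> \<le> 2 * (payoff_bound + 2 * \<Phi>)" for l
    using X[of "butlast l" "last l"] e[of "butlast l"] unfolding D_def by auto
  have "measure_pmf.expectation (pair_pmf (\<sigma> h) (\<tau> h)) (\<lambda>z. D (h @ [z])) = 0" for h
    by (cases "h = []") (simp_all add: D_def e_def measure_pmf.prob_space[simplified])
  from history_martingale_average_tendsto_0[OF this D]
  have "AE \<omega> in play_measure \<sigma> \<tau>. (\<lambda>T. (\<Sum>t<T. D (map \<omega> [0..<Suc t])) / real T) \<longlonglongrightarrow> 0" .
  then have "AE \<omega> in play_measure \<sigma> \<tau>.
      V \<le> real_of_ereal (liminf (\<lambda>T. ereal ((\<Sum>t<T. stage_payoff A S c \<omega> t) / real T)))"
  proof eventually_elim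
    fix \<omega> :: "nat \<Rightarrow> 'm \<times> 'n"
    assume lim: "(\<lambda>T. (\<Sum>t<T. D (map \<omega> [0..<Suc t])) / real T) \<longlonglongrightarrow> 0"
    define M where "M T = (\<Sum>t<T. D (map \<omega> [0..<Suc t]))" for T
    define U where "U T = (\<Sum>t<T. stage_payoff A S c \<omega> t)" for T
    have step: "U (Suc T) \<ge> V * real (Suc T) + M (Suc T) + \<phi> (snd (\<omega> 0)) - \<phi> (snd (\<omega> T)) - \<bar>V\<bar>" for T
    proof (induction T)
      case 0
      have "0 \<le> stage_payoff A S c \<omega> 0" by (rule stage_payoff_bounds)
      then show ?case by (simp add: U_def M_def D_def)
    next
      case (Suc T)
      let ?h = "map \<omega> [0..<Suc T]"
      have "V \<le> e ?h"
        unfolding e_def X_def by (rule drift) simp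
      moreover have "D (map \<omega> [0..<Suc (Suc T)]) = X ?h (\<omega> (Suc T)) - e ?h"
        by (simp add: D_def butlast_append)
      moreover have "X ?h (\<omega> (Suc T)) =
          stage_payoff A S c \<omega> (Suc T) + \<phi> (snd (\<omega> (Suc T))) - \<phi> (snd (\<omega> T))"
        by (simp add: X_def stage_payoff_history)
      moreover have "U (Suc (Suc T)) = U (Suc T) + stage_payoff A S c \<omega> (Suc T)"
        "M (Suc (Suc T)) = M (Suc T) + D (map \<omega> [0..<Suc (Suc T)])"
        by (simp_all add: U_def M_def del: upt_Suc)
      ultimately show ?case using Suc by (simp add: distrib_left del: upt_Suc)
    qed
    have "V + M T / real T - (2 * \<Phi> + \<bar>V\<bar>) / real T \<le> U T / real T" if "0 < T" for T
    proof -
      define T' where "T' = T - 1"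
      then have T': "T = Suc T'" using that by simp
      have "V * real T + M T - (2 * \<Phi> + \<bar>V\<bar>) \<le> U T"
        using step[of T'] \<phi>[of "snd (\<omega> 0)"] \<phi>[of "snd (\<omega> T')"] unfolding T' by linarith
      then have "(V * real T + M T - (2 * \<Phi> + \<bar>V\<bar>)) / real T \<le> U T / real T"
        by (rule divide_right_mono) simp
      then show ?thesis using that by (simp add: add_divide_distrib diff_divide_distrib)
    qed
    then have ev: "eventually (\<lambda>T. ereal (V + M T / real T - (2 * \<Phi> + \<bar>V\<bar>) / real T) \<le> ereal (U T / real T)) sequentially"
      by (intro eventually_mono[OF eventually_gt_at_top[of 0]]) auto
    have "(\<lambda>T. V + M T / real T - (2 * \<Phi> + \<bar>V\<bar>) / real T) \<longlonglongrightarrow> V + 0 - 0"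
      by (intro tendsto_diff tendsto_add tendsto_const lim_const_over_n lim[folded M_def])
    then have "liminf (\<lambda>T. ereal (V + M T / real T - (2 * \<Phi> + \<bar>V\<bar>) / real T)) = ereal V"
      by (intro lim_imp_Liminf) auto
    with Liminf_mono[OF ev] have "ereal V \<le> liminf (\<lambda>T. ereal (U T / real T))"
      by simp
    then show "V \<le> real_of_ereal (liminf (\<lambda>T. ereal ((\<Sum>t<T. stage_payoff A S c \<omega> t) / real T)))"
      unfolding U_def
      by (subst (asm) liminf_ereal_bounds(3)[OF average_bounds, symmetric]) simp
  qed
  moreover have "integrable (play_measure \<sigma> \<tau>)
      (\<lambda>\<omega>. real_of_ereal (liminf (\<lambda>T. ereal ((\<Sum>t<T. stage_payoff A S c \<omega> t) / real T))))"
  proof (rule integrable_const_bound[where B=payoff_bound])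
    have "0 \<le> real_of_ereal (liminf (\<lambda>T. ereal ((\<Sum>t<T. stage_payoff A S c \<omega> t) / real T)))
      \<and> real_of_ereal (liminf (\<lambda>T. ereal ((\<Sum>t<T. stage_payoff A S c \<omega> t) / real T))) \<le> payoff_bound" for \<omega>
    proof -
      note * = liminf_ereal_bounds[OF average_bounds[where \<omega>=\<omega>]]
      from *(2) show ?thesis
        by (subst (asm) *(3)[symmetric]) (simp add: real_of_ereal_pos *(1))
    qed
    then show "AE \<omega> in play_measure \<sigma> \<tau>.
        norm (real_of_ereal (liminf (\<lambda>T. ereal ((\<Sum>t<T. stage_payoff A S c \<omega> t) / real T)))) \<le> payoff_bound"
      by (intro AE_I2) (simp only: real_norm_def abs_of_nonneg)
  qed measurable
  ultimately show ?thesis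
    unfolding payoff_def by (rule integral_ge_const[rotated])
qed

text \<open>
  If Player 2 runs a Markov chain started in an invariant law \<open>q\<close>, then his column has law \<open>q\<close> at
  every stage, whatever Player 1 does, since Player 1 does not influence the chain. Player 1 can at
  best reply to the known current column.
\<close>

lemma payoff_le_stationary:
  fixes q :: "'n pmf" and y :: "'n \<Rightarrow> 'n pmf"
  assumes invariant: "\<And>j. (\<Sum>k\<in>UNIV. pmf q k * pmf (y k) j) = pmf q j"
  shows "payoff A S c \<sigma> (\<lambda>h. if h = [] then q else y (snd (last h))) \<le>
    (\<Sum>k\<in>UNIV. pmf q k * (best_reply A (\<chi> j. pmf (y k) j) + c * (\<Sum>j\<in>UNIV. pmf (y k) j * S $ k $ j)))"
proof -
  define \<tau> where "\<tau> = (\<lambda>h :: ('m \<times> 'n) list. if h = [] then q else y (snd (last h)))"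
  have \<tau>_Nil: "\<tau> [] = q" and \<tau>_last: "h \<noteq> [] \<Longrightarrow> \<tau> h = y (snd (last h))" for h
    by (simp_all add: \<tau>_def)
  have inner_sum: "(\<Sum>i\<in>UNIV. \<Sum>j\<in>UNIV. pmf p i * (pmf r j * g j)) = (\<Sum>j\<in>UNIV. pmf r j * g j)"
    for p :: "'m pmf" and r :: "'n pmf" and g :: "'n \<Rightarrow> real"
    by (simp add: sum_distrib_left[symmetric] sum_distrib_right[symmetric] sum_pmf_UNIV)
  have second: "measure_pmf.expectation (pair_pmf p r) (\<lambda>z. g (snd z)) = (\<Sum>j\<in>UNIV. pmf r j * g j)"
    for p :: "'m pmf" and r :: "'n pmf" and g :: "'n \<Rightarrow> real"
    by (simp only: expectation_pair_pmf snd_conv inner_sum)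
  have law: "(\<integral>\<omega>. g (snd (\<omega> t)) \<partial>play_measure \<sigma> \<tau>) = (\<Sum>k\<in>UNIV. pmf q k * g k)" for g :: "'n \<Rightarrow> real" and t
  proof (induction t arbitrary: g)
    case 0
    interpret prob_space "play_measure \<sigma> \<tau>" by (rule prob_space_play_measure)
    show ?case
      using integral_history_Suc[of \<sigma> \<tau> "\<lambda>l. g (snd (last l))" 0, unfolded Let_def last_snoc second]
      by (simp add: \<tau>_Nil prob_space)
  next
    case (Suc t)
    let ?g = "\<lambda>k. \<Sum>j\<in>UNIV. pmf (y k) j * g j"
    have "(\<integral>\<omega>. g (snd (\<omega> (Suc t))) \<partial>play_measure \<sigma> \<tau>) = (\<integral>\<omega>. ?g (snd (\<omega> t)) \<partial>play_measure \<sigma> \<tau>)"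
      using integral_history_Suc[of \<sigma> \<tau> "\<lambda>l. g (snd (last l))" "Suc t", unfolded Let_def last_snoc second]
      by (simp add: \<tau>_last)
    also have "\<dots> = (\<Sum>k\<in>UNIV. pmf q k * ?g k)"
      by (rule Suc.IH)
    also have "\<dots> = (\<Sum>j\<in>UNIV. (\<Sum>k\<in>UNIV. pmf q k * pmf (y k) j) * g j)"
      unfolding sum_distrib_left sum_distrib_right by (subst sum.swap) (simp add: mult.assoc)
    finally show ?case by (simp add: invariant)
  qed
  let ?G = "\<lambda>k. best_reply A (\<chi> j. pmf (y k) j) + c * (\<Sum>j\<in>UNIV. pmf (y k) j * S $ k $ j)"
  have "payoff A S c \<sigma> \<tau> \<le> (\<Sum>k\<in>UNIV. pmf q k * ?G k)"
  proof (rule payoff_le)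
    fix t :: nat assume "0 < t"
    then obtain t' where t: "t = Suc t'" by (cases t) auto
    have reply: "(\<Sum>i\<in>UNIV. \<Sum>j\<in>UNIV. pmf p i * (pmf (y k) j * (A $ i $ j + c * S $ k $ j))) \<le> ?G k"
      for p :: "'m pmf" and k
    proof -
      have "(\<Sum>i\<in>UNIV. \<Sum>j\<in>UNIV. pmf p i * (pmf (y k) j * A $ i $ j)) =
          (\<Sum>i\<in>UNIV. pmf p i * (A *v (\<chi> j. pmf (y k) j)) $ i)"
        by (simp add: matrix_vector_mult_def sum_distrib_left mult_ac)
      also have "\<dots> \<le> (\<Sum>i\<in>UNIV. pmf p i * best_reply A (\<chi> j. pmf (y k) j))"
        by (intro sum_mono mult_left_mono best_reply_ge) auto
      also have "\<dots> = best_reply A (\<chi> j. pmf (y k) j)"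
        by (simp add: sum_distrib_right[symmetric] sum_pmf_UNIV)
      moreover have "(\<Sum>i\<in>UNIV. \<Sum>j\<in>UNIV. pmf p i * (pmf (y k) j * (c * S $ k $ j))) =
          c * (\<Sum>j\<in>UNIV. pmf (y k) j * S $ k $ j)"
        unfolding inner_sum by (simp add: sum_distrib_left mult_ac)
      ultimately show ?thesis
        by (simp add: distrib_left sum.distrib)
    qed
    have "(\<integral>\<omega>. stage_payoff A S c \<omega> t \<partial>play_measure \<sigma> \<tau>) =
      (\<integral>\<omega>. (let h = map \<omega> [0..<t] in measure_pmf.expectation (pair_pmf (\<sigma> h) (\<tau> h))
          (\<lambda>z. history_payoff A S c h z)) \<partial>play_measure \<sigma> \<tau>)"
      unfolding stage_payoff_history' by (subst integral_history_Suc) simp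
    also have "\<dots> \<le> (\<integral>\<omega>. ?G (snd (\<omega> t')) \<partial>play_measure \<sigma> \<tau>)"
    proof (rule integral_mono)
      show "integrable (play_measure \<sigma> \<tau>) (\<lambda>\<omega>. let h = map \<omega> [0..<t] in
          measure_pmf.expectation (pair_pmf (\<sigma> h) (\<tau> h)) (history_payoff A S c h))"
        unfolding Let_def by (rule integrable_history[where F="\<lambda>h. measure_pmf.expectation (pair_pmf (\<sigma> h) (\<tau> h)) (history_payoff A S c h)"])
      show "integrable (play_measure \<sigma> \<tau>) (\<lambda>\<omega>. ?G (snd (\<omega> t')))"
        using integrable_history[of \<sigma> \<tau> "\<lambda>l. ?G (snd (last l))" t] by (simp add: t)
      show "(let h = map \<omega> [0..<t] in
          measure_pmf.expectation (pair_pmf (\<sigma> h) (\<tau> h)) (history_payoff A S c h)) \<le> ?G (snd (\<omega> t'))" for \<omega>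
        using reply[of _ "snd (\<omega> t')"]
        by (simp add: Let_def t expectation_pair_pmf \<tau>_last history_payoff_def)
    qed
    also have "\<dots> = (\<Sum>k\<in>UNIV. pmf q k * ?G k)" by (rule law)
    finally show "(\<integral>\<omega>. stage_payoff A S c \<omega> t \<partial>play_measure \<sigma> \<tau>) \<le> (\<Sum>k\<in>UNIV. pmf q k * ?G k)" .
  qed
  then show ?thesis by (simp only: \<tau>_def)
qed

end

section \<open>Flows between columns\<close>

text \<open>
  \<open>x $ k $ j\<close> is the long-run frequency of moves from column \<open>k\<close> to column \<open>j\<close>. Such frequencies are
  balanced: each column is left as often as it is entered.
\<close>

definition flows :: "(real ^ 'n::finite ^ 'n) set" where
  "flows = {x. (\<forall>k j. 0 \<le> x $ k $ j) \<and> (\<Sum>k\<in>UNIV. \<Sum>j\<in>UNIV. x $ k $ j) = 1 \<and>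
               (\<forall>k. (\<Sum>j\<in>UNIV. x $ k $ j) = (\<Sum>j\<in>UNIV. x $ j $ k))}"

lemma
  assumes "x \<in> flows"
  shows flows_nonneg: "0 \<le> x $ k $ j"
    and flows_total: "(\<Sum>k\<in>UNIV. \<Sum>j\<in>UNIV. x $ k $ j) = 1"
    and flows_balanced: "(\<Sum>j\<in>UNIV. x $ k $ j) = (\<Sum>j\<in>UNIV. x $ j $ k)"
  using assms unfolding flows_def by blast+

definition flow_cost ::
  "real ^ 'n::finite ^ 'm::finite \<Rightarrow> real ^ 'n ^ 'n \<Rightarrow> real \<Rightarrow> real ^ 'n ^ 'n \<Rightarrow> real" where
  "flow_cost A S c x =
     (\<Sum>k\<in>UNIV. best_reply A (x $ k)) + c * (\<Sum>k\<in>UNIV. \<Sum>j\<in>UNIV. x $ k $ j * S $ k $ j)"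

definition flow_value :: "real ^ 'n::finite ^ 'm::finite \<Rightarrow> real ^ 'n ^ 'n \<Rightarrow> real \<Rightarrow> real" where
  "flow_value A S c = (INF x\<in>flows. flow_cost A S c x)"

lemma quadratic_form_eq: "y \<bullet> (S *v y) = (\<Sum>k\<in>UNIV. \<Sum>j\<in>UNIV. y $ k * y $ j * S $ k $ j)"
  for S :: "real ^ 'n::finite ^ 'n"
  by (simp add: inner_vec_def matrix_vector_mult_def sum_distrib_left mult_ac)

text \<open>
  A static strategy chooses consecutive columns independently, and so induces a product flow.
\<close>

lemma
  assumes y: "y \<in> mixed"
  shows product_flow: "(\<chi> k j. y $ k * y $ j) \<in> flows"
    and flow_cost_product_flow: "flow_cost A S c (\<chi> k j. y $ k * y $ j) = static_payoff A S c y"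
proof -
  have sum_y: "(\<Sum>j\<in>UNIV. y $ j) = 1" and y_nonneg: "0 \<le> y $ k" for k
    using y by (auto simp: mixed_def)
  show "(\<chi> k j. y $ k * y $ j) \<in> flows"
    using y_nonneg
    by (auto simp: flows_def sum_distrib_left[symmetric] sum_distrib_right[symmetric] sum_y)
  have row: "(\<chi> k j. y $ k * y $ j) $ k = y $ k *\<^sub>R y" for k
    by (simp add: vec_eq_iff)
  show "flow_cost A S c (\<chi> k j. y $ k * y $ j) = static_payoff A S c y"
    unfolding flow_cost_def row static_payoff_eq quadratic_form_eq
    by (simp add: best_reply_scaleR y_nonneg sum_distrib_right[symmetric] sum_y)
qed

lemma flows_nonempty: "flows \<noteq> {}"
  using product_flow[OF axis_in_mixed] by blast

lemma best_reply_axis: "best_reply A (axis j 1) = (MAX i. A $ i $ j)"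
  by (simp add: best_reply_def matrix_vector_mult_basis column_def)

lemma best_reply_nonneg:
  assumes "switching_game A S" "\<And>j. 0 \<le> z $ j"
  shows "0 \<le> best_reply A z"
proof -
  have "0 \<le> (A *v z) $ undefined"
    using assms by (auto simp: matrix_vector_mult_def switching_game_def intro!: sum_nonneg)
  then show ?thesis using best_reply_ge order_trans by blast
qed

lemma flow_switching_bounds:
  assumes "switching_game A S" "x \<in> flows"
  shows "0 \<le> (\<Sum>k\<in>UNIV. \<Sum>j\<in>UNIV. x $ k $ j * S $ k $ j)"
    "(\<Sum>k\<in>UNIV. \<Sum>j\<in>UNIV. x $ k $ j * S $ k $ j) \<le> (\<Sum>k\<in>UNIV. \<Sum>j\<in>UNIV. S $ k $ j)"
proof -
  have S: "0 \<le> S $ k $ j" for k j using assms by (auto simp: switching_game_def)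
  have x: "0 \<le> x $ k $ j" for k j using assms by (auto simp: flows_def)
  have x1: "x $ k $ j \<le> 1" for k j
  proof -
    have "x $ k $ j \<le> (\<Sum>k\<in>UNIV. \<Sum>j\<in>UNIV. x $ k $ j)"
      by (rule order_trans[OF member_le_sum[of j UNIV "\<lambda>j. x $ k $ j"]
          member_le_sum[of k UNIV "\<lambda>k. \<Sum>j\<in>UNIV. x $ k $ j"]]) (auto simp: x sum_nonneg)
    moreover have "(\<Sum>k\<in>UNIV. \<Sum>j\<in>UNIV. x $ k $ j) = 1"
      by (rule flows_total[OF assms(2)])
    ultimately show ?thesis by (simp only:)
  qed
  show "0 \<le> (\<Sum>k\<in>UNIV. \<Sum>j\<in>UNIV. x $ k $ j * S $ k $ j)"
    by (intro sum_nonneg mult_nonneg_nonneg S x)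
  show "(\<Sum>k\<in>UNIV. \<Sum>j\<in>UNIV. x $ k $ j * S $ k $ j) \<le> (\<Sum>k\<in>UNIV. \<Sum>j\<in>UNIV. S $ k $ j)"
    by (intro sum_mono mult_left_le_one_le S x x1)
qed

lemma flow_cost_nonneg:
  assumes "switching_game A S" "0 \<le> c" "x \<in> flows"
  shows "0 \<le> flow_cost A S c x"
  unfolding flow_cost_def
  using assms(3)
  by (intro add_nonneg_nonneg sum_nonneg[where f="\<lambda>k. best_reply A (x $ k)"]
      mult_nonneg_nonneg[OF assms(2) flow_switching_bounds(1)[OF assms(1,3)]]
      best_reply_nonneg[OF assms(1)]) (simp add: flows_def)

lemma bdd_below_flow_cost:
  "switching_game A S \<Longrightarrow> 0 \<le> c \<Longrightarrow> bdd_below (flow_cost A S c ` flows)"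
  by (rule bdd_belowI[of _ 0]) (auto simp: flow_cost_nonneg)

lemma flow_value_le: "switching_game A S \<Longrightarrow> 0 \<le> c \<Longrightarrow> x \<in> flows \<Longrightarrow> flow_value A S c \<le> flow_cost A S c x"
  unfolding flow_value_def by (intro cINF_lower bdd_below_flow_cost)

lemma flow_value_greatest: "(\<And>x. x \<in> flows \<Longrightarrow> B \<le> flow_cost A S c x) \<Longrightarrow> B \<le> flow_value A S c"
  unfolding flow_value_def by (intro cINF_greatest flows_nonempty)

lemma flow_value_le_static_payoff:
  "switching_game A S \<Longrightarrow> 0 \<le> c \<Longrightarrow> y \<in> mixed \<Longrightarrow> flow_value A S c \<le> static_payoff A S c y"
  by (metis flow_value_le product_flow flow_cost_product_flow)

text \<open>
  For a fixed flow the cost is affine in \<open>c\<close>, with slope the expected switching cost. An infimum of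
  such functions is concave, nondecreasing and Lipschitz. The final bound rests on concavity, the two
  thresholds on monotonicity and Lipschitz continuity.
\<close>

lemma flow_value_concave:
  assumes game: "switching_game A S" and c: "0 \<le> a" "0 \<le> b" and u: "0 \<le> u" "0 \<le> w" "u + w = 1"
  shows "u * flow_value A S a + w * flow_value A S b \<le> flow_value A S (u * a + w * b)"
proof (rule flow_value_greatest)
  fix x :: "real ^ 'a ^ 'a" assume x: "x \<in> flows"
  have "u * flow_value A S a + w * flow_value A S b \<le> u * flow_cost A S a x + w * flow_cost A S b x"
    using u by (intro add_mono mult_left_mono flow_value_le game c x)
  also have "\<dots> = (u + w) * (\<Sum>k\<in>UNIV. best_reply A (x $ k)) +
      (u * a + w * b) * (\<Sum>k\<in>UNIV. \<Sum>j\<in>UNIV. x $ k $ j * S $ k $ j)"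
    by (simp add: flow_cost_def algebra_simps)
  also have "\<dots> = flow_cost A S (u * a + w * b) x"
    by (simp add: flow_cost_def u)
  finally show "u * flow_value A S a + w * flow_value A S b \<le> flow_cost A S (u * a + w * b) x" .
qed

lemma flow_value_mono:
  assumes game: "switching_game A S" and c: "0 \<le> a" "a \<le> b"
  shows "flow_value A S a \<le> flow_value A S b"
proof (rule flow_value_greatest)
  fix x :: "real ^ 'a ^ 'a" assume x: "x \<in> flows"
  have "flow_value A S a \<le> flow_cost A S a x"
    by (rule flow_value_le[OF game c(1) x])
  also have "\<dots> \<le> flow_cost A S b x"
    unfolding flow_cost_def
    using flow_switching_bounds(1)[OF game x] c by (intro add_left_mono mult_right_mono)
  finally show "flow_value A S a \<le> flow_cost A S b x" .
qed

lemma flow_value_Lipschitz: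
  assumes game: "switching_game A S" and c: "0 \<le> a" "a \<le> b"
  shows "flow_value A S b - (b - a) * (\<Sum>k\<in>UNIV. \<Sum>j\<in>UNIV. S $ k $ j) \<le> flow_value A S a"
proof (rule flow_value_greatest)
  fix x :: "real ^ 'a ^ 'a" assume x: "x \<in> flows"
  have "flow_value A S b \<le> flow_cost A S b x"
    using c by (intro flow_value_le[OF game _ x]) simp
  also have "\<dots> = flow_cost A S a x + (b - a) * (\<Sum>k\<in>UNIV. \<Sum>j\<in>UNIV. x $ k $ j * S $ k $ j)"
    by (simp add: flow_cost_def left_diff_distrib)
  also have "\<dots> \<le> flow_cost A S a x + (b - a) * (\<Sum>k\<in>UNIV. \<Sum>j\<in>UNIV. S $ k $ j)"
    using flow_switching_bounds(2)[OF game x] c by (intro add_left_mono mult_left_mono) auto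
  finally show "flow_value A S b - (b - a) * (\<Sum>k\<in>UNIV. \<Sum>j\<in>UNIV. S $ k $ j) \<le> flow_cost A S a x"
    by simp
qed

lemma one_shot_value_le:
  assumes "switching_game A S" "y \<in> mixed"
  shows "one_shot_value A \<le> best_reply A y"
  unfolding one_shot_value_def worst_case_eq_best_reply
proof (rule cINF_lower[OF _ assms(2)])
  show "bdd_below (best_reply A ` mixed)"
    by (rule bdd_belowI[of _ 0]) (auto simp: mixed_def intro: best_reply_nonneg[OF assms(1)])
qed

text \<open>
  Without switching costs, knowing the previous column cannot hurt Player 1: by subadditivity his
  best replies to the individual rows of a flow yield at least the best reply to its marginal.
\<close>

lemma one_shot_value_le_flow_value:
  assumes game: "switching_game A S"
  shows "one_shot_value A \<le> flow_value A S 0"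
proof (rule flow_value_greatest)
  fix x :: "real ^ 'a ^ 'a" assume x: "x \<in> flows"
  have "(\<Sum>k\<in>UNIV. x $ k) \<in> mixed"
  proof -
    have "(\<Sum>j\<in>UNIV. \<Sum>k\<in>UNIV. x $ k $ j) = 1"
      by (subst sum.swap) (rule flows_total[OF x])
    then show ?thesis
      by (simp add: mixed_def sum_nonneg flows_nonneg[OF x])
  qed
  then have "one_shot_value A \<le> best_reply A (\<Sum>k\<in>UNIV. x $ k)"
    by (rule one_shot_value_le[OF game])
  also have "\<dots> \<le> flow_cost A S 0 x"
    using best_reply_sum[of UNIV A "($) x"] by (simp add: flow_cost_def)
  finally show "one_shot_value A \<le> flow_cost A S 0 x" .
qed

lemma pure_minimax_value_le: "pure_minimax_value A \<le> (MAX i. A $ i $ j)"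
  unfolding pure_minimax_value_def by (rule Min_le) auto

text \<open>
  Player 1 replies to column \<open>k\<close> as if it were repeated. If it is, he gets at least the pure minimax
  value; if it is not, the switching cost alone is at least \<open>1\<close> since \<open>1 \<le> c\<close>, and no entry of \<open>A\<close>
  exceeds \<open>1\<close>.
\<close>

lemma pure_minimax_value_le_flow_value:
  fixes A :: "real ^ 'n::finite ^ 'm::finite"
  assumes game: "switching_game A S" and pos: "\<And>k j. k \<noteq> j \<Longrightarrow> S $ k $ j > 0" and c: "1 \<le> c"
  shows "pure_minimax_value A \<le> flow_value A S c"
proof (rule flow_value_greatest)
  fix x :: "real ^ 'n ^ 'n" assume x: "x \<in> flows"
  let ?v = "pure_minimax_value A"
  have A: "0 \<le> A $ i $ j" "A $ i $ j \<le> 1" and S: "0 \<le> S $ k $ j" for i j k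
    using game by (auto simp: switching_game_def)
  have x_nonneg: "0 \<le> x $ k $ j" for k j using x by (auto simp: flows_def)
  have v1: "?v \<le> 1"
    by (rule order_trans[OF pure_minimax_value_le[of A undefined]]) (auto simp: A)
  have row: "?v * (\<Sum>j\<in>UNIV. x $ k $ j) \<le> best_reply A (x $ k) + c * (\<Sum>j\<in>UNIV. x $ k $ j * S $ k $ j)" for k
  proof -
    have "(MAX i. A $ i $ k) \<in> range (\<lambda>i. A $ i $ k)" by (rule Max_in) auto
    then obtain i where i: "(MAX i. A $ i $ k) = A $ i $ k" by (rule rangeE)
    have "?v \<le> A $ i $ j + c * S $ k $ j" for j
    proof (cases "j = k")
      case True
      have "?v \<le> A $ i $ k" using pure_minimax_value_le[of A k] i by simp
      moreover have "0 \<le> c * S $ k $ j" using c S by simp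
      ultimately show ?thesis using True by simp
    next
      case False
      then have "1 \<le> S $ k $ j"
        using pos[of k j] game by (auto simp: switching_game_def)
      then have "1 * 1 \<le> c * S $ k $ j" using c by (intro mult_mono) auto
      then show ?thesis using v1 A(1)[of i j] by simp
    qed
    then have "(\<Sum>j\<in>UNIV. ?v * x $ k $ j) \<le> (\<Sum>j\<in>UNIV. (A $ i $ j + c * S $ k $ j) * x $ k $ j)"
      by (intro sum_mono mult_right_mono x_nonneg)
    also have "\<dots> = (A *v (x $ k)) $ i + c * (\<Sum>j\<in>UNIV. x $ k $ j * S $ k $ j)"
      by (simp add: matrix_vector_mult_def sum.distrib sum_distrib_left algebra_simps)
    also have "\<dots> \<le> best_reply A (x $ k) + c * (\<Sum>j\<in>UNIV. x $ k $ j * S $ k $ j)"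
      by (intro add_right_mono best_reply_ge)
    finally show ?thesis by (simp add: sum_distrib_left)
  qed
  have "?v = (\<Sum>k\<in>UNIV. ?v * (\<Sum>j\<in>UNIV. x $ k $ j))"
    unfolding sum_distrib_left[symmetric] flows_total[OF x] by simp
  also have "\<dots> \<le> (\<Sum>k\<in>UNIV. best_reply A (x $ k) + c * (\<Sum>j\<in>UNIV. x $ k $ j * S $ k $ j))"
    by (intro sum_mono row)
  also have "\<dots> = flow_cost A S c x"
    by (simp add: flow_cost_def sum.distrib sum_distrib_left)
  finally show "?v \<le> flow_cost A S c x" .
qed

section \<open>The value of the repeated game\<close>

text \<open>
  Normalizing the rows of a flow gives the transition probabilities of a Markov chain for which the
  row sums are invariant. Columns of frequency zero are never visited, so the choice made there is
  arbitrary.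
\<close>

lemma flow_strategy:
  assumes game: "switching_game A S" and c: "0 \<le> c" and x: "x \<in> flows"
  obtains \<tau> where "\<And>\<sigma>. payoff A S c \<sigma> \<tau> \<le> flow_cost A S c x"
proof -
  define m where "m k = (\<Sum>j\<in>UNIV. x $ k $ j)" for k
  have x_nonneg: "0 \<le> x $ k $ j" for k j using x by (auto simp: flows_def)
  have m_nonneg: "0 \<le> m k" for k unfolding m_def by (intro sum_nonneg x_nonneg)
  have x_0: "x $ k $ j = 0" if "m k = 0" for k j
    using that x_nonneg unfolding m_def by (subst (asm) sum_nonneg_eq_0_iff) auto
  define q where "q = mixed_pmf (\<chi> k. m k)"
  define r where "r k = (if m k = 0 then axis k 1 else (1 / m k) *\<^sub>R x $ k)" for k
  define y where "y k = mixed_pmf (r k)" for k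
  have "(\<chi> k. m k) \<in> mixed"
    using flows_total[OF x] m_nonneg by (simp add: mixed_def m_def)
  then have pmf_q: "pmf q k = m k" for k by (simp add: q_def pmf_mixed_pmf)
  have "r k \<in> mixed" for k
  proof (cases "m k = 0")
    case False
    then show ?thesis
      using x_nonneg m_nonneg by (auto simp: r_def mixed_def sum_divide_distrib[symmetric] m_def[symmetric])
  qed (simp add: r_def axis_in_mixed)
  then have pmf_y: "pmf (y k) j = r k $ j" for k j by (simp add: y_def pmf_mixed_pmf)
  have m_r: "m k *\<^sub>R r k = x $ k" for k
    using x_0[of k] by (auto simp: r_def vec_eq_iff)
  have m_r': "m k * r k $ j = x $ k $ j" for k j
    using m_r[of k] by (auto simp: vec_eq_iff)
  show ?thesis
  proof
    fix \<sigma> :: "('b, 'a) strategy1"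
    have "payoff A S c \<sigma> (\<lambda>h. if h = [] then q else y (snd (last h))) \<le>
      (\<Sum>k\<in>UNIV. pmf q k * (best_reply A (\<chi> j. pmf (y k) j) + c * (\<Sum>j\<in>UNIV. pmf (y k) j * S $ k $ j)))"
    proof (rule payoff_le_stationary[OF game c])
      show "(\<Sum>k\<in>UNIV. pmf q k * pmf (y k) j) = pmf q j" for j
        using x by (simp add: pmf_q pmf_y m_r') (simp add: m_def flows_balanced[OF x])
    qed
    also have "\<dots> = (\<Sum>k\<in>UNIV. best_reply A (x $ k) + c * (\<Sum>j\<in>UNIV. x $ k $ j * S $ k $ j))"
    proof (rule sum.cong[OF refl])
      fix k
      have "m k * best_reply A (r k) = best_reply A (x $ k)"
        using best_reply_scaleR[OF m_nonneg, of A k "r k"] by (simp add: m_r)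
      then show "pmf q k * (best_reply A (\<chi> j. pmf (y k) j) + c * (\<Sum>j\<in>UNIV. pmf (y k) j * S $ k $ j)) =
          best_reply A (x $ k) + c * (\<Sum>j\<in>UNIV. x $ k $ j * S $ k $ j)"
        by (simp add: pmf_q pmf_y distrib_left sum_distrib_left m_r'[symmetric] mult_ac)
    qed
    also have "\<dots> = flow_cost A S c x"
      by (simp add: flow_cost_def sum.distrib sum_distrib_left)
    finally show "payoff A S c \<sigma> (\<lambda>h. if h = [] then q else y (snd (last h))) \<le> flow_cost A S c x" .
  qed
qed

text \<open>
  Linear programming duality for the flow problem, up to an arbitrarily small loss. The set \<open>K\<close> of
  tables that are dominated by the gains over \<open>V\<close> that mixed actions \<open>p\<close> and potentials \<open>h\<close> can
  guarantee is convex. If it missed the origin, a separating hyperplane would exist whose normal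
  vector, up to sign and scale, is a flow of cost at most \<open>V\<close>: it has constant sign because \<open>K\<close> is
  closed downward, and is balanced because the potentials range over a linear space. Since \<open>V\<close> lies
  strictly below the value, \<open>K\<close> need not be closed.
\<close>

lemma flow_value_potentials:
  fixes A :: "real ^ 'n::finite ^ 'm::finite"
  assumes game: "switching_game A S" and c: "0 \<le> c" and V: "V < flow_value A S c"
  obtains p :: "'n \<Rightarrow> real ^ 'm" and \<phi> :: "'n \<Rightarrow> real" where "\<And>k. p k \<in> mixed"
    "\<And>k j. V \<le> (\<Sum>i\<in>UNIV. p k $ i * A $ i $ j) + c * S $ k $ j + \<phi> j - \<phi> k"
proof -
  define gain where "gain p h k j = (\<Sum>i\<in>UNIV. p $ k $ i * A $ i $ j) + c * S $ k $ j + h $ j - h $ k - V"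
    for p :: "real ^ 'm ^ 'n" and h :: "real ^ 'n" and k j
  define K where "K = {z :: real ^ 'n ^ 'n. \<exists>p h. (\<forall>k. p $ k \<in> mixed) \<and> (\<forall>k j. z $ k $ j \<le> gain p h k j)}"
  have K_I: "(\<chi> k j. gain p h k j) \<in> K" if "\<And>k. p $ k \<in> mixed" for p h
    unfolding K_def using that by auto
  have "convex K"
  proof (rule convexI)
    fix z z' and u w :: real
    assume "z \<in> K" "z' \<in> K" and u: "0 \<le> u" "0 \<le> w" "u + w = 1"
    then obtain p h p' h' where p: "\<And>k. p $ k \<in> mixed" "\<And>k j. z $ k $ j \<le> gain p h k j"
      and p': "\<And>k. p' $ k \<in> mixed" "\<And>k j. z' $ k $ j \<le> gain p' h' k j"
      unfolding K_def by auto
    have "(u *\<^sub>R p + w *\<^sub>R p') $ k \<in> mixed" for k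
      using p(1)[of k] p'(1)[of k] u
      by (auto simp: mixed_def sum.distrib sum_distrib_left[symmetric])
    moreover have "(u *\<^sub>R z + w *\<^sub>R z') $ k $ j \<le> gain (u *\<^sub>R p + w *\<^sub>R p') (u *\<^sub>R h + w *\<^sub>R h') k j" for k j
    proof -
      have "(u *\<^sub>R z + w *\<^sub>R z') $ k $ j \<le> u * gain p h k j + w * gain p' h' k j"
        using p(2)[of k j] p'(2)[of k j] u by (auto intro!: add_mono mult_left_mono)
      also have "\<dots> = u * ((\<Sum>i\<in>UNIV. p $ k $ i * A $ i $ j) + h $ j - h $ k)
          + w * ((\<Sum>i\<in>UNIV. p' $ k $ i * A $ i $ j) + h' $ j - h' $ k) + (u + w) * (c * S $ k $ j - V)"
        unfolding gain_def by (simp add: algebra_simps)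
      also have "\<dots> = gain (u *\<^sub>R p + w *\<^sub>R p') (u *\<^sub>R h + w *\<^sub>R h') k j"
        unfolding gain_def by (simp add: u sum.distrib sum_distrib_left algebra_simps)
      finally show ?thesis .
    qed
    ultimately show "u *\<^sub>R z + w *\<^sub>R z' \<in> K"
      unfolding K_def by blast
  qed
  have "0 \<in> K"
  proof (rule ccontr)
    assume "0 \<notin> K"
    with separating_hyperplane_set_0[OF \<open>convex K\<close>]
    obtain a where "a \<noteq> 0" and a: "\<And>z. z \<in> K \<Longrightarrow> 0 \<le> a \<bullet> z" by blast
    have inner: "a \<bullet> z = (\<Sum>k\<in>UNIV. \<Sum>j\<in>UNIV. a $ k $ j * z $ k $ j)" for z
      by (simp add: inner_vec_def)
    have "\<forall>k. \<exists>i. best_reply A (- a $ k) = (A *v (- a $ k)) $ i"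
      by (intro allI) (rule best_reply_attained, blast)
    then obtain best where best: "best_reply A (- a $ k) = (A *v (- a $ k)) $ best k" for k
      by metis
    define p where "p = ((\<chi> k. axis (best k) 1) :: real ^ 'm ^ 'n)"
    have p: "p $ k \<in> mixed" for k by (simp add: p_def axis_in_mixed)
    define z0 where "z0 = (\<chi> k j. gain p 0 k j)"
    have z0: "z0 \<in> K" unfolding z0_def by (rule K_I[OF p])
    have a_nonpos: "a $ k $ j \<le> 0" for k j
    proof (rule ccontr)
      assume "\<not> a $ k $ j \<le> 0"
      then have pos: "0 < a $ k $ j" by simp
      define t where "t = (a \<bullet> z0 + 1) / a $ k $ j"
      have "0 \<le> t" using a[OF z0] pos by (simp add: t_def)
      then have "(z0 - t *\<^sub>R axis k (axis j 1)) $ k' $ j' \<le> gain p 0 k' j'" for k' j'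
        by (simp add: z0_def axis_def)
      then have "z0 - t *\<^sub>R axis k (axis j 1) \<in> K"
        using p unfolding K_def by blast
      from a[OF this] have "0 \<le> a \<bullet> z0 - t * a $ k $ j"
        by (simp add: inner_diff_right inner_axis)
      also have "\<dots> = - 1" using pos by (simp add: t_def)
      finally show False by simp
    qed
    have balanced: "(\<Sum>j\<in>UNIV. a $ l $ j) = (\<Sum>j\<in>UNIV. a $ j $ l)" for l
    proof -
      define b where "b = (\<Sum>j\<in>UNIV. a $ j $ l) - (\<Sum>j\<in>UNIV. a $ l $ j)"
      have lin: "0 \<le> a \<bullet> z0 + t * b" for t
      proof -
        have "(\<Sum>k\<in>UNIV. \<Sum>j\<in>UNIV. a $ k $ j * (axis l t :: real ^ 'n) $ j) = t * (\<Sum>k\<in>UNIV. a $ k $ l)"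
          by (simp add: axis_def if_distrib sum_distrib_left mult_ac cong: if_cong)
        moreover have "(\<Sum>k\<in>UNIV. \<Sum>j\<in>UNIV. a $ k $ j * (axis l t :: real ^ 'n) $ k) = t * (\<Sum>j\<in>UNIV. a $ l $ j)"
          unfolding sum_distrib_right[symmetric]
          by (simp add: axis_def if_distrib[where f="\<lambda>r. _ * r"] cong: if_cong)
        moreover have "a \<bullet> (\<chi> k j. gain p (axis l t) k j) = (\<Sum>k\<in>UNIV. \<Sum>j\<in>UNIV. a $ k $ j * gain p 0 k j
            + a $ k $ j * (axis l t :: real ^ 'n) $ j - a $ k $ j * (axis l t :: real ^ 'n) $ k)"
          unfolding inner by (simp add: gain_def algebra_simps)
        ultimately have "a \<bullet> (\<chi> k j. gain p (axis l t) k j) = a \<bullet> z0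
            + t * (\<Sum>k\<in>UNIV. a $ k $ l) - t * (\<Sum>j\<in>UNIV. a $ l $ j)"
          by (simp only: sum.distrib sum_subtractf inner[of z0]) (simp add: z0_def)
        then have "a \<bullet> (\<chi> k j. gain p (axis l t) k j) = a \<bullet> z0 + t * b"
          by (simp add: b_def right_diff_distrib)
        then show ?thesis using a[OF K_I[OF p, of "axis l t"]] by simp
      qed
      have "b = 0"
      proof (rule ccontr)
        assume "b \<noteq> 0"
        then show False using lin[of "- (a \<bullet> z0 + 1) / b"] by simp
      qed
      then show ?thesis by (simp add: b_def)
    qed
    define M where "M = (\<Sum>k\<in>UNIV. \<Sum>j\<in>UNIV. - a $ k $ j)"
    have "M \<noteq> 0"
    proof
      assume "M = 0"
      then have "a $ k $ j = 0" for k j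
        unfolding M_def using a_nonpos by (simp add: sum_nonneg_eq_0_iff sum_nonneg)
      then show False using \<open>a \<noteq> 0\<close> by (simp add: vec_eq_iff)
    qed
    moreover have "0 \<le> M" unfolding M_def using a_nonpos by (intro sum_nonneg) simp
    ultimately have M: "0 < M" by simp
    define x where "x = (1 / M) *\<^sub>R (- a)"
    have x_entry: "x $ k $ j = - a $ k $ j / M" for k j
      by (simp add: x_def)
    have x: "x \<in> flows"
      unfolding flows_def mem_Collect_eq
    proof (intro conjI allI)
      show "0 \<le> x $ k $ j" for k j
        unfolding x_entry using M a_nonpos[of k j] by (intro divide_nonneg_pos) auto
      show "(\<Sum>k\<in>UNIV. \<Sum>j\<in>UNIV. x $ k $ j) = 1"
        unfolding x_entry sum_divide_distrib[symmetric] M_def[symmetric] using M by simp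
      show "(\<Sum>j\<in>UNIV. x $ k $ j) = (\<Sum>j\<in>UNIV. x $ j $ k)" for k
        unfolding x_entry sum_divide_distrib[symmetric] sum_negf balanced ..
    qed
    have "- (a \<bullet> z0) = (\<Sum>k\<in>UNIV. best_reply A (- a $ k)) + c * (\<Sum>k\<in>UNIV. \<Sum>j\<in>UNIV. - a $ k $ j * S $ k $ j) - V * M"
    proof -
      have "(\<Sum>i\<in>UNIV. p $ k $ i * A $ i $ j) = A $ best k $ j" for k j
        by (simp add: p_def axis_def if_distrib[where f="\<lambda>r. r * _"] cong: if_cong)
      then show ?thesis
        unfolding inner z0_def M_def best
        by (simp add: gain_def matrix_vector_mult_def sum_distrib_left sum_subtractf sum.distrib sum_negf algebra_simps)
    qed
    also have "\<dots> = M * (flow_cost A S c x - V)"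
    proof -
      have "best_reply A (- a $ k) = M * best_reply A (x $ k)" for k
        using best_reply_scaleR[of M A "x $ k"] M by (simp add: x_def)
      moreover have "- a $ k $ j = M * x $ k $ j" for k j
        using M by (simp add: x_def)
      ultimately show ?thesis
        by (simp add: flow_cost_def sum_distrib_left algebra_simps)
    qed
    finally have "M * (flow_cost A S c x - V) \<le> 0" using a[OF z0] by simp
    then have "flow_cost A S c x \<le> V" using M by (simp add: mult_le_0_iff)
    then show False using V flow_value_le[OF game c x] by simp
  qed
  then obtain p h where "\<And>k. p $ k \<in> mixed" "\<And>k j. 0 \<le> gain p h k j"
    unfolding K_def by auto
  then show ?thesis
    by (intro that[of "\<lambda>k. p $ k" "\<lambda>k. h $ k"]) (auto simp: gain_def)
qed

text \<open>
  Player 1 plays \<open>p k\<close> after column \<open>k\<close>. The dual inequality holds for every column that Player 2 may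
  choose next, hence for every mixed action of his.
\<close>

lemma potential_strategy:
  fixes A :: "real ^ 'n::finite ^ 'm::finite"
  assumes game: "switching_game A S" and c: "0 \<le> c" and V: "V < flow_value A S c"
  obtains \<sigma> where "\<And>\<tau>. V \<le> payoff A S c \<sigma> \<tau>"
proof -
  obtain p :: "'n \<Rightarrow> real ^ 'm" and \<phi> :: "'n \<Rightarrow> real" where p: "\<And>k. p k \<in> mixed"
    and \<phi>: "\<And>k j. V \<le> (\<Sum>i\<in>UNIV. p k $ i * A $ i $ j) + c * S $ k $ j + \<phi> j - \<phi> k"
    using flow_value_potentials[OF assms] by blast
  define \<sigma> where "\<sigma> h = mixed_pmf (p (snd (last h)))" for h :: "('m \<times> 'n) list"
  show ?thesis
  proof
    fix \<tau> :: "('m, 'n) strategy2"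
    show "V \<le> payoff A S c \<sigma> \<tau>"
    proof (rule payoff_ge[OF game c])
      fix h :: "('m \<times> 'n) list" assume h: "h \<noteq> []"
      define k where "k = snd (last h)"
      have \<sigma>: "pmf (\<sigma> h) i = p k $ i" for i by (simp add: \<sigma>_def k_def pmf_mixed_pmf p)
      have sum_p: "(\<Sum>i\<in>UNIV. p k $ i) = 1" using p[of k] by (simp add: mixed_def)
      have "V = (\<Sum>j\<in>UNIV. pmf (\<tau> h) j * V)"
        by (simp add: sum_distrib_right[symmetric] sum_pmf_UNIV)
      also have "\<dots> \<le> (\<Sum>j\<in>UNIV. pmf (\<tau> h) j * ((\<Sum>i\<in>UNIV. p k $ i * A $ i $ j) + c * S $ k $ j + \<phi> j - \<phi> k))"
        by (intro sum_mono mult_left_mono \<phi>) auto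
      also have "\<dots> = (\<Sum>j\<in>UNIV. pmf (\<tau> h) j * (\<Sum>i\<in>UNIV. p k $ i * (A $ i $ j + c * S $ k $ j + \<phi> j - \<phi> k)))"
      proof -
        have "(\<Sum>i\<in>UNIV. p k $ i * (A $ i $ j + c * S $ k $ j + \<phi> j - \<phi> k)) =
            (\<Sum>i\<in>UNIV. p k $ i * A $ i $ j) + (\<Sum>i\<in>UNIV. p k $ i) * (c * S $ k $ j + \<phi> j - \<phi> k)" for j
          unfolding sum_distrib_right by (simp add: sum.distrib[symmetric] algebra_simps)
        then show ?thesis by (simp add: sum_p add_diff_eq add.assoc)
      qed
      also have "\<dots> = (\<Sum>i\<in>UNIV. \<Sum>j\<in>UNIV. pmf (\<sigma> h) i * (pmf (\<tau> h) j * (A $ i $ j + c * S $ k $ j + \<phi> j - \<phi> k)))"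
        unfolding \<sigma> sum_distrib_left by (subst sum.swap) (simp add: mult_ac)
      also have "\<dots> = measure_pmf.expectation (pair_pmf (\<sigma> h) (\<tau> h))
          (\<lambda>z. history_payoff A S c h z + \<phi> (snd z) - \<phi> (snd (last h)))"
        using h by (simp add: expectation_pair_pmf history_payoff_def k_def)
      finally show "V \<le> measure_pmf.expectation (pair_pmf (\<sigma> h) (\<tau> h))
          (\<lambda>z. history_payoff A S c h z + \<phi> (snd z) - \<phi> (snd (last h)))" .
    qed
  qed
qed

text \<open>
  Weak duality between supremum and infimum is immediate; the strategies obtained from flows and from
  potentials enclose both of them between values that are arbitrarily close to the flow value.
\<close>

theorem game_value_eq_flow_value:
  fixes A :: "real ^ 'n::finite ^ 'm::finite"
  assumes game: "switching_game A S" and c: "0 \<le> c"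
  shows "game_value A S c = flow_value A S c"
proof -
  let ?lower = "SUP \<sigma>. INF \<tau>. payoff A S c \<sigma> \<tau>" and ?upper = "INF \<tau>. SUP \<sigma>. payoff A S c \<sigma> \<tau>"
  let ?B = "payoff_bound S c"
  note nonneg = payoff_nonneg[OF game c] and bound = payoff_le_bound[OF game c]
  have below: "bdd_below (range (payoff A S c \<sigma>))" for \<sigma>
    by (rule bdd_belowI[of _ 0]) (auto simp: nonneg)
  have above: "bdd_above (range (\<lambda>\<sigma>. payoff A S c \<sigma> \<tau>))" for \<tau>
    by (rule bdd_aboveI[of _ ?B]) (auto simp: bound)
  have inf_le: "(INF \<tau>. payoff A S c \<sigma> \<tau>) \<le> payoff A S c \<sigma> \<tau>" for \<sigma> \<tau>
    by (rule cINF_lower[OF below]) simp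
  have le_sup: "payoff A S c \<sigma> \<tau> \<le> (SUP \<sigma>. payoff A S c \<sigma> \<tau>)" for \<sigma> \<tau>
    by (rule cSUP_upper[OF _ above]) simp
  have "?lower \<le> ?upper"
    by (intro cSUP_least cINF_greatest order_trans[OF inf_le le_sup]) auto
  moreover have "?upper \<le> flow_value A S c"
  proof (rule flow_value_greatest)
    fix x :: "real ^ 'n ^ 'n" assume "x \<in> flows"
    then obtain \<tau> where \<tau>: "\<And>\<sigma> :: ('m, 'n) strategy1. payoff A S c \<sigma> \<tau> \<le> flow_cost A S c x"
      using flow_strategy[OF game c] by blast
    have "?upper \<le> (SUP \<sigma>. payoff A S c \<sigma> \<tau>)"
      by (intro cINF_lower bdd_belowI[of _ 0]) (auto intro: order_trans[OF nonneg le_sup])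
    also have "\<dots> \<le> flow_cost A S c x"
      by (intro cSUP_least \<tau>) simp
    finally show "?upper \<le> flow_cost A S c x" .
  qed
  moreover have "flow_value A S c \<le> ?lower"
  proof (rule dense_le)
    fix V assume "V < flow_value A S c"
    then obtain \<sigma> where \<sigma>: "\<And>\<tau> :: ('m, 'n) strategy2. V \<le> payoff A S c \<sigma> \<tau>"
      using potential_strategy[OF game c] by blast
    have "V \<le> (INF \<tau>. payoff A S c \<sigma> \<tau>)"
      by (intro cINF_greatest \<sigma>) simp
    also have "\<dots> \<le> ?lower"
      by (intro cSUP_upper bdd_aboveI[of _ ?B]) (auto intro: order_trans[OF inf_le bound])
    finally show "V \<le> ?lower" .
  qed
  ultimately have "?lower = flow_value A S c" "?upper = flow_value A S c"
    by linarith+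
  then show ?thesis
    unfolding game_value_def by (intro the_equality) auto
qed

section \<open>The two thresholds\<close>

lemma static_value_le:
  assumes game: "switching_game A S" and c: "0 \<le> c" and y: "y \<in> mixed"
  shows "static_value A S c \<le> static_payoff A S c y"
  unfolding static_value_def
proof (rule cINF_lower[OF _ y])
  show "bdd_below (static_payoff A S c ` mixed)"
    using flow_value_le_static_payoff[OF game c] by (auto intro!: bdd_belowI)
qed

lemma flow_value_le_static_value:
  assumes "switching_game A S" "0 \<le> c"
  shows "flow_value A S c \<le> static_value A S c"
  unfolding static_value_def
proof (rule cINF_greatest)
  show "mixed \<noteq> ({} :: (real ^ 'a) set)" using axis_in_mixed by blast
qed (rule flow_value_le_static_payoff[OF assms])

lemma optimal_mixed_iff: "y \<in> optimal_mixed A \<longleftrightarrow> y \<in> mixed \<and> best_reply A y = one_shot_value A"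
  by (simp add: optimal_mixed_def worst_case_eq_best_reply)

lemma quadratic_form_axis: "axis j 1 \<bullet> (S *v axis j 1) = S $ j $ j" for S :: "real ^ 'n::finite ^ 'n"
  by (simp add: inner_axis' matrix_vector_mult_basis column_def)

lemma static_payoff_axis:
  "switching_game A S \<Longrightarrow> static_payoff A S c (axis j 1) = (MAX i. A $ i $ j)"
  by (simp add: static_payoff_eq best_reply_axis quadratic_form_axis switching_game_def)

lemma flow_value_le_pure_minimax_value:
  assumes "switching_game A S" "0 \<le> c" "pure_minimax_action A j"
  shows "flow_value A S c \<le> pure_minimax_value A"
  using flow_value_le_static_payoff[OF assms(1,2) axis_in_mixed[of j]] assms
  by (simp add: static_payoff_axis pure_minimax_action_def)

text \<open>
  A mixed action that is not pure puts weight on two different columns and switches between them.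
\<close>

lemma quadratic_form_pos:
  fixes y :: "real ^ 'n::finite" and S :: "real ^ 'n ^ 'n"
  assumes S: "\<And>k j. 0 \<le> S $ k $ j" "\<And>k j. k \<noteq> j \<Longrightarrow> 0 < S $ k $ j"
    and y: "y \<in> mixed" and not_pure: "\<And>j. y \<noteq> axis j 1"
  shows "0 < y \<bullet> (S *v y)"
proof -
  have y_nonneg: "0 \<le> y $ k" for k using y by (simp add: mixed_def)
  have sum_y: "(\<Sum>k\<in>UNIV. y $ k) = 1" using y by (simp add: mixed_def)
  have "\<exists>k. 0 < y $ k"
  proof (rule ccontr)
    assume "\<nexists>k. 0 < y $ k"
    then have "y $ k = 0" for k using y_nonneg[of k] by (simp add: order_antisym not_less)
    then show False using sum_y by simp
  qed
  then obtain k where k: "0 < y $ k" ..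
  have "\<exists>j. j \<noteq> k \<and> 0 < y $ j"
  proof (rule ccontr)
    assume "\<nexists>j. j \<noteq> k \<and> 0 < y $ j"
    then have zero: "y $ j = 0" if "j \<noteq> k" for j
      using that y_nonneg[of j] by (meson not_less order_antisym)
    have "y $ k = 1"
      using sum_y by (subst (asm) sum.remove[of _ k]) (auto simp: zero)
    then have "y = axis k 1" by (auto simp: vec_eq_iff axis_def zero)
    then show False using not_pure by blast
  qed
  then obtain j where j: "j \<noteq> k" "0 < y $ j" by blast
  have "0 < y $ k * y $ j * S $ k $ j"
    using k j S(2)[of k j] by simp
  also have "\<dots> \<le> (\<Sum>k\<in>UNIV. \<Sum>j\<in>UNIV. y $ k * y $ j * S $ k $ j)"
    by (rule order_trans[OF member_le_sum[of j UNIV "\<lambda>j. y $ k * y $ j * S $ k $ j"]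
          member_le_sum[of k UNIV "\<lambda>k. \<Sum>j\<in>UNIV. y $ k * y $ j * S $ k $ j"]])
       (auto simp: y_nonneg S(1) intro!: sum_nonneg)
  finally show ?thesis by (simp add: quadratic_form_eq)
qed

text \<open>
  A static strategy that is optimal on \<open>{0..d}\<close> is optimal at \<open>c = 0\<close>, hence optimal in the one-shot
  game, and \<open>ystar\<close> switches at the least cost among those. So the condition on \<open>d\<close> amounts to the
  game value being the affine function \<open>v + c s\<close> on \<open>{0..d}\<close>. This set of \<open>d\<close> contains \<open>0\<close>, is bounded
  because the value never exceeds the pure minimax value while \<open>s > 0\<close>, and contains its supremum
  because the value is monotone.
\<close>

lemma lower_threshold_properties:
  fixes A :: "real ^ 'n::finite ^ 'm::finite" and S :: "real ^ 'n ^ 'n"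
  assumes game: "switching_game A S"
    and ystar: "is_arg_min (\<lambda>y. y \<bullet> (S *v y)) (\<lambda>y. y \<in> optimal_mixed A) ystar"
    and s: "s = ystar \<bullet> (S *v ystar)" "0 < s"
  shows "0 \<le> lower_threshold A S"
    "game_value A S (lower_threshold A S) = one_shot_value A + lower_threshold A S * s"
proof -
  let ?V = "flow_value A S" and ?v = "one_shot_value A"
  have y_mixed: "ystar \<in> mixed" and y_opt: "best_reply A ystar = ?v"
    using ystar by (auto simp: is_arg_min_def optimal_mixed_iff)
  have s_min: "s \<le> y \<bullet> (S *v y)" if "y \<in> optimal_mixed A" for y
    using ystar that by (force simp: is_arg_min_def s)
  have static_ystar: "static_payoff A S c ystar = ?v + c * s" for c
    by (simp add: static_payoff_eq y_opt s)
  have V_le: "?V c \<le> ?v + c * s" if "0 \<le> c" for c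
    using flow_value_le_static_payoff[OF game that y_mixed] by (simp add: static_ystar)
  have V_0: "?V 0 = ?v"
    using V_le[of 0] one_shot_value_le_flow_value[OF game] by simp
  define D where "D = {d. 0 \<le> d \<and> (\<forall>c\<in>{0..d}. ?V c = ?v + c * s)}"
  have D_iff: "0 \<le> d \<and> (\<exists>y\<in>mixed. \<forall>c\<in>{0..d}. game_value A S c = static_value A S c \<and>
      static_payoff A S c y = static_value A S c) \<longleftrightarrow> d \<in> D" for d
  proof
    assume L: "0 \<le> d \<and> (\<exists>y\<in>mixed. \<forall>c\<in>{0..d}. game_value A S c = static_value A S c \<and>
      static_payoff A S c y = static_value A S c)"
    then obtain y where y: "y \<in> mixed" and d: "0 \<le> d"
      and eq: "\<And>c. c \<in> {0..d} \<Longrightarrow> ?V c = static_value A S c \<and> static_payoff A S c y = static_value A S c"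
      by (auto simp: game_value_eq_flow_value[OF game])
    have "best_reply A y = ?v"
      using eq[of 0] d V_0 by (simp add: static_payoff_eq)
    then have "s \<le> y \<bullet> (S *v y)"
      using y by (intro s_min) (simp add: optimal_mixed_iff)
    have "?V c = ?v + c * s" if "c \<in> {0..d}" for c
    proof (rule antisym[OF V_le])
      have "?v + c * s \<le> static_payoff A S c y"
        using \<open>s \<le> _\<close> that by (simp add: static_payoff_eq \<open>best_reply A y = ?v\<close> mult_left_mono)
      then show "?v + c * s \<le> ?V c" using eq[OF that] by simp
    qed (use that in simp)
    then show "d \<in> D" using d by (simp add: D_def)
  next
    assume d: "d \<in> D"
    have "game_value A S c = static_value A S c \<and> static_payoff A S c ystar = static_value A S c"
      if c: "c \<in> {0..d}" for c
    proof -
      have "?V c = ?v + c * s" using d c by (auto simp: D_def)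
      moreover have "?V c \<le> static_value A S c" "static_value A S c \<le> ?v + c * s"
        using c flow_value_le_static_value[OF game] static_value_le[OF game _ y_mixed] by (auto simp: static_ystar)
      ultimately show ?thesis
        using c by (simp add: static_ystar game_value_eq_flow_value[OF game])
    qed
    then show "0 \<le> d \<and> (\<exists>y\<in>mixed. \<forall>c\<in>{0..d}. game_value A S c = static_value A S c \<and>
      static_payoff A S c y = static_value A S c)"
      using y_mixed d unfolding D_def by blast
  qed
  have D_0: "0 \<in> D" by (simp add: D_def V_0)
  obtain j where j: "pure_minimax_action A j"
  proof -
    have "pure_minimax_value A \<in> range (\<lambda>j. MAX i. A $ i $ j)"
      unfolding pure_minimax_value_def by (rule Min_in) auto
    then show thesis by (rule rangeE) (simp add: that pure_minimax_action_def)
  qed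
  have D_bdd: "d \<le> (pure_minimax_value A - ?v) / s" if "d \<in> D" for d
    using that flow_value_le_pure_minimax_value[OF game _ j, of d] s(2)
    by (auto simp: D_def pos_le_divide_eq)
  then have bdd: "bdd_above D" by (rule bdd_aboveI)
  define d where "d = Sup D"
  have d_upper: "e \<le> d" if "e \<in> D" for e
    unfolding d_def by (rule cSup_upper[OF that bdd])
  have below: "?V c = ?v + c * s" if "0 \<le> c" "c < d" for c
  proof -
    have "\<exists>e\<in>D. c < e"
      using that D_0 unfolding d_def by (intro less_cSupD) auto
    then obtain e where "e \<in> D" "c < e" by blast
    then show ?thesis using that by (auto simp: D_def)
  qed
  have "?v + d * s \<le> ?V d"
  proof (cases "d = 0")
    case True
    then show ?thesis by (simp add: V_0)
  next
    case False
    then have d: "0 < d" using d_upper[OF D_0] by simp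
    have "d \<le> (?V d - ?v) / s"
    proof (rule dense_le_bounded[OF d])
      fix c assume c: "0 < c" "c < d"
      then have "?v + c * s \<le> ?V d"
        using below[of c] flow_value_mono[OF game, of c d] by simp
      then show "c \<le> (?V d - ?v) / s" using s(2) by (simp add: pos_le_divide_eq)
    qed
    then show ?thesis using s(2) by (simp add: pos_le_divide_eq)
  qed
  then have V_d: "?V d = ?v + d * s"
    using V_le[of d] d_upper[OF D_0] by simp
  have "d \<in> D"
    unfolding D_def using below V_d d_upper[OF D_0] by (auto simp: le_less)
  then have "lower_threshold A S = d"
    unfolding lower_threshold_def D_iff by (intro Greatest_equality d_upper)
  then show "0 \<le> lower_threshold A S"
    "game_value A S (lower_threshold A S) = one_shot_value A + lower_threshold A S * s"
    using d_upper[OF D_0] V_d by (simp_all add: game_value_eq_flow_value[OF game])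
qed

text \<open>
  Against a constant column the best that Player 1 can get is the maximum of that column, and he does
  get it by repeating a maximizing row.
\<close>

lemma optimal2_pure_iff:
  fixes A :: "real ^ 'n::finite ^ 'm::finite" and S :: "real ^ 'n ^ 'n"
  assumes game: "switching_game A S" and c: "0 \<le> c" and j: "pure_minimax_action A j"
  shows "optimal2 A S c (\<lambda>_. return_pmf j) \<longleftrightarrow> pure_minimax_value A \<le> game_value A S c"
proof
  assume opt: "optimal2 A S c (\<lambda>_. return_pmf j)"
  have "(MAX i. A $ i $ j) \<in> range (\<lambda>i. A $ i $ j)" by (rule Max_in) auto
  then obtain i where "(MAX i. A $ i $ j) = A $ i $ j" by (rule rangeE)
  then have i: "A $ i $ j = pure_minimax_value A"
    using j by (simp add: pure_minimax_action_def)
  have "pure_minimax_value A \<le> payoff A S c (\<lambda>_. return_pmf i) (\<lambda>_. return_pmf j)"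
  proof (rule payoff_ge[OF game c, where \<phi>="\<lambda>_. 0"])
    fix h :: "('m \<times> 'n) list" assume "h \<noteq> []"
    then have "history_payoff A S c h (i, j) = pure_minimax_value A + c * S $ snd (last h) $ j"
      by (simp add: history_payoff_def i)
    moreover have "0 \<le> c * S $ snd (last h) $ j"
      using game c by (simp add: switching_game_def)
    moreover have "pair_pmf (return_pmf i) (return_pmf j) = return_pmf (i, j)"
      by (simp add: pair_return_pmf1)
    ultimately show "pure_minimax_value A \<le> measure_pmf.expectation (pair_pmf (return_pmf i) (return_pmf j))
        (\<lambda>z. history_payoff A S c h z + 0 - 0)"
      by simp
  qed
  also have "\<dots> \<le> game_value A S c"
    using opt by (simp add: optimal2_def)
  finally show "pure_minimax_value A \<le> game_value A S c" .
next
  assume le: "pure_minimax_value A \<le> game_value A S c"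
  show "optimal2 A S c (\<lambda>_. return_pmf j)"
    unfolding optimal2_def
  proof
    fix \<sigma> :: "('m, 'n) strategy1"
    have delta: "(\<chi> k. pmf (return_pmf j) k) = (axis j 1 :: real ^ 'n)"
      by (auto simp: vec_eq_iff axis_def indicator_def)
    have "payoff A S c \<sigma> (\<lambda>h. if h = [] then return_pmf j else return_pmf j) \<le>
      (\<Sum>k\<in>UNIV. pmf (return_pmf j) k * (best_reply A (\<chi> k. pmf (return_pmf j) k)
          + c * (\<Sum>l\<in>UNIV. pmf (return_pmf j) l * S $ k $ l)))"
      by (rule payoff_le_stationary[OF game c]) (simp add: sum_distrib_right[symmetric] sum_pmf_UNIV del: pmf_return)
    also have "\<dots> = (MAX i. A $ i $ j) + c * S $ j $ j"
      unfolding delta by (simp add: best_reply_axis indicator_def if_distrib[where f="\<lambda>r. r * _"] cong: if_cong)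
    also have "\<dots> = pure_minimax_value A"
      using game j by (simp add: switching_game_def pure_minimax_action_def)
    finally show "payoff A S c \<sigma> (\<lambda>_. return_pmf j) \<le> game_value A S c"
      using le by simp
  qed
qed

text \<open>
  The costs \<open>c\<close> at which the value has reached the pure minimax value form a set that is closed upward
  by monotonicity, contains \<open>1\<close>, and contains its infimum by Lipschitz continuity.
\<close>

lemma upper_threshold_properties:
  fixes A :: "real ^ 'n::finite ^ 'm::finite" and S :: "real ^ 'n ^ 'n"
  assumes game: "switching_game A S" and pos: "\<And>k j. k \<noteq> j \<Longrightarrow> S $ k $ j > 0"
    and j: "pure_minimax_action A j"
  shows "0 \<le> upper_threshold A S j" "game_value A S (upper_threshold A S j) = pure_minimax_value A"
proof -
  let ?V = "flow_value A S" and ?w = "pure_minimax_value A"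
  define U where "U = {c. 0 \<le> c \<and> ?w \<le> ?V c}"
  have U_1: "1 \<in> U"
    using pure_minimax_value_le_flow_value[OF game pos, of 1] by (simp add: U_def)
  have bdd: "bdd_below U" by (rule bdd_belowI[of _ 0]) (simp add: U_def)
  define d where "d = Inf U"
  have "U \<noteq> {}" using U_1 by blast
  then have d: "0 \<le> d"
    unfolding d_def by (rule cInf_greatest) (simp add: U_def)
  define L where "L = (\<Sum>k\<in>UNIV. \<Sum>j\<in>UNIV. S $ k $ j)"
  have L: "0 \<le> L"
    unfolding L_def using game by (intro sum_nonneg) (simp add: switching_game_def)
  have "?w \<le> ?V d"
  proof (rule field_le_epsilon)
    fix e :: real assume e: "0 < e"
    have "d < d + e / (L + 1)" using e L by simp
    then obtain c where c: "c \<in> U" "c < d + e / (L + 1)"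
      unfolding d_def using U_1 bdd by (subst (asm) cInf_less_iff) auto
    have dc: "d \<le> c" unfolding d_def by (rule cInf_lower[OF c(1) bdd])
    have "?w \<le> ?V c" using c by (simp add: U_def)
    also have "\<dots> \<le> ?V d + (c - d) * L"
      using flow_value_Lipschitz[OF game d dc] by (simp add: L_def)
    also have "(c - d) * L \<le> (e / (L + 1)) * (L + 1)"
      using c(2) L dc by (intro mult_mono) auto
    also have "\<dots> = e" using L by simp
    finally show "?w \<le> ?V d + e" by simp
  qed
  then have iff: "optimal2 A S c (\<lambda>_. return_pmf j) \<longleftrightarrow> d \<le> c" if "0 \<le> c" for c
    using that flow_value_mono[OF game d, of c] cInf_lower[OF _ bdd, of c]
    by (auto simp: optimal2_pure_iff[OF game that j] game_value_eq_flow_value[OF game] U_def d_def)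
  have "upper_threshold A S j = d"
    unfolding upper_threshold_def
  proof (rule the_equality)
    show "0 \<le> d \<and> (\<forall>c\<ge>0. optimal2 A S c (\<lambda>_. return_pmf j) \<longleftrightarrow> d \<le> c)"
      using d iff by simp
    show "d' = d" if "0 \<le> d' \<and> (\<forall>c\<ge>0. optimal2 A S c (\<lambda>_. return_pmf j) \<longleftrightarrow> d' \<le> c)" for d'
      using that d iff by (meson order_antisym order_refl)
  qed
  then show "0 \<le> upper_threshold A S j" "game_value A S (upper_threshold A S j) = pure_minimax_value A"
    using d \<open>?w \<le> ?V d\<close> flow_value_le_pure_minimax_value[OF game d j]
    by (simp_all add: game_value_eq_flow_value[OF game])
qed

section \<open>Mixing two static strategies\<close>

lemma static_payoff_mix_le:
  fixes A :: "real ^ 'n::finite ^ 'm::finite" and S :: "real ^ 'n ^ 'n"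
  assumes u: "0 \<le> u" "u \<le> 1" 
  shows "static_payoff A S c (u *\<^sub>R y + (1 - u) *\<^sub>R z) \<le>
    u * best_reply A y + (1 - u) * best_reply A z +
    c * (u\<^sup>2 * (y \<bullet> (S *v y)) + u * (1 - u) * (y \<bullet> (S *v z) + z \<bullet> (S *v y)) + (1 - u)\<^sup>2 * (z \<bullet> (S *v z)))"
proof -
  have "best_reply A (u *\<^sub>R y + (1 - u) *\<^sub>R z) \<le> u * best_reply A y + (1 - u) * best_reply A z"
    using best_reply_add[of A "u *\<^sub>R y" "(1 - u) *\<^sub>R z"] u by (simp add: best_reply_scaleR)
  moreover have "(u *\<^sub>R y + (1 - u) *\<^sub>R z) \<bullet> (S *v (u *\<^sub>R y + (1 - u) *\<^sub>R z)) =
      u\<^sup>2 * (y \<bullet> (S *v y)) + u * (1 - u) * (y \<bullet> (S *v z) + z \<bullet> (S *v y)) + (1 - u)\<^sup>2 * (z \<bullet> (S *v z))"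
    by (simp add: matrix_vector_right_distrib matrix_vector_mult_scaleR inner_add_left inner_add_right
        power2_eq_square algebra_simps)
  ultimately show ?thesis by (simp add: static_payoff_eq)
qed

theorem theorem3:
  fixes A :: "real ^ 'n::finite ^ 'm::finite" and S :: "real ^ 'n ^ 'n"
    and ystar ybar :: "real ^ 'n" and jbar :: 'n
    and v vbar s shat c_lo c_hi c0 c1 c2 c :: real
    and bound \<Delta> :: "real \<Rightarrow> real"
  assumes "switching_game A S"
    and "\<not> (\<exists>j. worst_case A (axis j 1) = one_shot_value A)"
    and "\<And>k j. k \<noteq> j \<Longrightarrow> S $ k $ j > 0"
    and "is_arg_min (\<lambda>y. y \<bullet> (S *v y)) (\<lambda>y. y \<in> optimal_mixed A) ystar"
    and "pure_minimax_action A jbar"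
    and "ybar = axis jbar 1"
    and "v = one_shot_value A"
    and "vbar = pure_minimax_value A"
    and "c_lo = lower_threshold A S"
    and "c_hi = upper_threshold A S jbar"
    and "s = ystar \<bullet> (S *v ystar)"
    and "shat = ystar \<bullet> (S *v ybar) + ybar \<bullet> (S *v ystar)"
    and "c0 = (vbar - v) / s"
    and "c1 = s / (2 * s - shat) * c0"
    and "c2 = s / shat * c0"
    and "\<And>c. bound c = (if c \<le> c0 then (c - c_lo) * ((c_hi - c0) / (c_hi - c_lo)) * s
                       else (c_hi - c) * ((c0 - c_lo) / (c_hi - c_lo)) * s)"
    and "\<And>c. \<Delta> c = (vbar - v - c_lo * s) * ((c_hi - c) / (c_hi - c_lo))
                 - (vbar - v - c * shat)\<^sup>2 / (4 * c * (s - shat))"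
    and "s > shat"
    and "c \<in> {c1..c2} \<inter> {c_lo<..<c_hi}"
  shows "static_value A S c - game_value A S c \<le> \<Delta> c \<and> \<Delta> c \<le> bound c
           \<and> (c1 < c \<and> c < c2 \<longrightarrow> \<Delta> c < bound c)"
proof -
  note game = assms(1) and pos = assms(3) and jbar = assms(5)
  have S_nonneg: "0 \<le> S $ k $ j" for k j using game by (simp add: switching_game_def)
  have ystar: "ystar \<in> mixed" "best_reply A ystar = v"
    using assms(4) by (auto simp: is_arg_min_def optimal_mixed_iff assms(7))
  have ybar: "ybar \<in> mixed" "best_reply A ybar = vbar" "ybar \<bullet> (S *v ybar) = 0"
    using game jbar by (simp_all add: assms(6,8) axis_in_mixed best_reply_axis quadratic_form_axis
        pure_minimax_action_def switching_game_def)
  have not_pure: "ystar \<noteq> axis j 1" for j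
    using assms(2) ystar by (auto simp: worst_case_eq_best_reply assms(7))
  have s_pos: "0 < s"
    unfolding assms(11) by (rule quadratic_form_pos[OF S_nonneg pos ystar(1) not_pure])
  have "vbar \<noteq> v"
    using assms(2) ybar(2) by (auto simp: worst_case_eq_best_reply assms(6,7))
  then have v_less: "v < vbar"
    using one_shot_value_le[OF game ybar(1)] ybar(2) by (simp add: assms(7))
  have form_nonneg: "0 \<le> y \<bullet> (S *v z)" if "y \<in> mixed" "z \<in> mixed" for y z
    using that S_nonneg
    by (auto simp: mixed_def inner_vec_def matrix_vector_mult_def intro!: sum_nonneg mult_nonneg_nonneg)
  have shat_nonneg: "0 \<le> shat"
    unfolding assms(12) using ystar(1) ybar(1) by (intro add_nonneg_nonneg form_nonneg)
  have lo: "0 \<le> c_lo" "game_value A S c_lo = v + c_lo * s"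
    using lower_threshold_properties[OF game assms(4) assms(11) s_pos] by (simp_all add: assms(7,9))
  have hi: "0 \<le> c_hi" "game_value A S c_hi = vbar"
    using upper_threshold_properties[OF game pos jbar] by (simp_all add: assms(8,10))
  have c: "c_lo < c" "c < c_hi" "c1 \<le> c" "c \<le> c2" using assms(19) by auto
  then have c_pos: "0 < c" and gap: "0 < c_hi - c_lo" using lo by auto
  have shat_pos: "0 < shat"
    using shat_nonneg c(4) c_pos assms(15) by (cases "shat = 0") auto
  define g where "g = vbar - v"
  have g_pos: "0 < g" using v_less by (simp add: g_def)
  have c0: "s * c0 = g" and c1: "c1 = g / (2 * s - shat)" and c2: "c2 = g / shat"
    using s_pos by (simp_all add: assms(13-15) g_def)
  have den: "0 < 2 * s - shat" "0 < s - shat" using assms(18) s_pos by auto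
  \<comment> \<open>The weight \<open>u\<close> on \<open>ystar\<close> that is chosen below is at most 1 from \<open>c1\<close> on and nonnegative up to \<open>c2\<close>.\<close>
  have c2_iff: "c \<le> c2 \<longleftrightarrow> c * shat \<le> g" "c < c2 \<longleftrightarrow> c * shat < g"
    using shat_pos by (simp_all add: c2 pos_le_divide_eq pos_less_divide_eq)
  have c1_iff: "c1 \<le> c \<longleftrightarrow> g - c * shat \<le> 2 * (c * (s - shat))" "c1 < c \<longleftrightarrow> g - c * shat < 2 * (c * (s - shat))"
    using den(1) by (simp_all add: c1 pos_divide_le_eq pos_divide_less_eq algebra_simps)
  define b where "b = c * (s - shat)"
  define a where "a = g - c * shat"
  have b_pos: "0 < b" using c_pos den by (simp add: b_def)
  have a: "0 \<le> a" "a \<le> 2 * b" using c c2_iff(1) c1_iff(1) by (auto simp: a_def b_def)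
  define Q where "Q = a\<^sup>2 / (4 * b)"
  \<comment> \<open>\<open>v + chord\<close> is the height at \<open>c\<close> of the chord of the value function between the two thresholds.\<close>
  define chord where "chord = g - (g - c_lo * s) * ((c_hi - c) / (c_hi - c_lo))"
  have \<Delta>: "\<Delta> c = g - chord - Q"
    by (simp add: assms(17) g_def[symmetric] chord_def Q_def a_def b_def mult_ac)
  have static: "static_value A S c \<le> v + (g - Q)"
  proof -
    \<comment> \<open>This weight minimizes the quadratic upper bound \<open>vbar - u * a + u\<^sup>2 * b\<close> of the static payoff.\<close>
    define u where "u = a / (2 * b)"
    have u: "0 \<le> u" "u \<le> 1" using a b_pos by (simp_all add: u_def)
    let ?y = "u *\<^sub>R ystar + (1 - u) *\<^sub>R ybar"
    have "?y \<in> mixed"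
      using ystar(1) ybar(1) u by (auto simp: mixed_def sum.distrib sum_distrib_left[symmetric])
    then have "static_value A S c \<le> static_payoff A S c ?y"
      using c_pos by (intro static_value_le[OF game]) auto
    also have "\<dots> \<le> u * v + (1 - u) * vbar + c * (u\<^sup>2 * s + u * (1 - u) * shat)"
      using static_payoff_mix_le[OF u, of A S c ystar ybar] ystar ybar by (simp add: assms(11,12))
    also have "\<dots> = v + (g - u * a + u\<^sup>2 * b)"
      by (simp add: g_def a_def b_def power2_eq_square algebra_simps)
    also have "u * a - u\<^sup>2 * b = Q"
      using b_pos by (simp add: u_def Q_def power2_eq_square field_simps)
    then have "v + (g - u * a + u\<^sup>2 * b) = v + (g - Q)" by simp
    finally show ?thesis .
  qed
  have chord_le: "v + chord \<le> game_value A S c"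
  proof -
    define w where "w = (c_hi - c) / (c_hi - c_lo)"
    have w: "0 \<le> w" "w \<le> 1" using c gap by (simp_all add: w_def)
    have w_c: "w * c_lo + (1 - w) * c_hi = c"
    proof -
      have "w * (c_hi - c_lo) = c_hi - c" using gap by (simp add: w_def)
      then show ?thesis by (simp add: algebra_simps)
    qed
    have "v + chord = w * (v + c_lo * s) + (1 - w) * vbar"
      by (simp add: chord_def w_def[symmetric] g_def algebra_simps)
    also have "\<dots> = w * flow_value A S c_lo + (1 - w) * flow_value A S c_hi"
      using lo hi by (simp add: game_value_eq_flow_value[OF game])
    also have "\<dots> \<le> flow_value A S (w * c_lo + (1 - w) * c_hi)"
      using w lo hi by (intro flow_value_concave[OF game]) auto
    also have "\<dots> = game_value A S c"
      using c_pos by (simp add: w_c game_value_eq_flow_value[OF game])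
    finally show ?thesis .
  qed
  \<comment> \<open>The original bound compares the chord with \<open>ystar\<close> alone up to \<open>c0\<close>, and with \<open>ybar\<close> alone afterwards.\<close>
  have bound: "bound c = (if c \<le> c0 then c * s - chord else g - chord)"
  proof -
    have "(c - c_lo) * ((c_hi - c0) / (c_hi - c_lo)) * s = (c - c_lo) * (c_hi * s - g) / (c_hi - c_lo)"
      by (simp add: c0[symmetric] algebra_simps)
    also have "\<dots> = c * s - chord"
    proof -
      have "(c - c_lo) * (c_hi * s - g) = (c * s - g) * (c_hi - c_lo) + (g - c_lo * s) * (c_hi - c)"
        by (simp add: algebra_simps)
      then show ?thesis using gap by (simp add: chord_def add_divide_distrib)
    qed
    finally have 1: "(c - c_lo) * ((c_hi - c0) / (c_hi - c_lo)) * s = c * s - chord" .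
    have 2: "(c_hi - c) * ((c0 - c_lo) / (c_hi - c_lo)) * s = g - chord"
      by (simp add: chord_def c0[symmetric] algebra_simps)
    show ?thesis unfolding assms(16) 1 2 ..
  qed
  have square: "Q - (a - b) = (a - 2 * b)\<^sup>2 / (4 * b)"
    using b_pos by (simp add: Q_def power2_eq_square field_simps)
  have gs: "g - c * s = a - b" by (simp add: a_def b_def algebra_simps)
  have "0 \<le> (a - 2 * b)\<^sup>2 / (4 * b)" "0 \<le> Q"
    using b_pos by (simp_all add: Q_def)
  then have "0 \<le> Q" "a - b \<le> Q"
    using square by linarith+
  moreover have "0 < Q" "a - b < Q" if "c1 < c" "c < c2"
  proof -
    have "0 < a" "a - 2 * b \<noteq> 0" using that c1_iff(2) c2_iff(2) by (auto simp: a_def b_def)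
    then have "0 < (a - 2 * b)\<^sup>2 / (4 * b)" "0 < a\<^sup>2 / (4 * b)" using b_pos by simp_all
    then show "0 < Q" "a - b < Q" using square by (auto simp: Q_def)
  qed
  ultimately show ?thesis
    using static chord_le gs by (auto simp: \<Delta> bound)
qed

end
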